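(* For each of the three problem variants (non-preemptive, preemptive and splittable scheduling with batch setup times) there is a $2$-approximation algorithm running in time $\mathcal{O}(n)$, i.e. an algorithm that, for every instance, computes in time $\mathcal{O}(n)$ a feasible schedule whose makespan is at most $2\,\mathrm{OPT}$, where $\mathrm{OPT}$ is the optimal makespan of the respective variant.
   Context: An instance consists of $m\in\mathbb{N}$ identical parallel machines, a set $J$ of $n$ jobs, a partition $J=C_1\,\dot\cup\,\dots\,\dot\cup\, C_c$ into $c$ nonempty classes, a processing time $t_j\in\mathbb{N}=\{1,2,\dots\}$ for every job $j$, and a setup time $s_i\in\mathbb{N}$ for every class $i\in[c]=\{1,\dots,c\}$. In a schedule every machine processes at most one item (setup or job/job piece) at a time; a setup of class $i$ (of length $s_i$) must be processed on a machine whenever that machine starts processing load of class $i$ and whenever it switches from processing load of one class to load of a different class $i$; no setup is needed between jobs (pieces) of the same class; setups are never preempted. The makespan is the maximum completion time over all machines. Non-preemptive variant: every job is processed without interruption on a single machine. Preemptive variant: jobs may be preempted and split into pieces processed on arbitrary machines, but no two pieces of the same job may be processed at overlapping times. Splittable variant: jobs may be split into arbitrarily many pieces which may be processed on any machines at any times, also in parallel; in this variant a schedule may be output as a list of machine configurations with multiplicities. *)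

theory Defs
  imports Complex_Main "HOL-Library.Landau_Symbols"
begin

section \<open>Instances\<close>

text \<open>Jobs are numbered from 0 to \<open>njobs - 1\<close> in an arbitrary order, classes from 0 to
  \<open>nclasses - 1\<close>; the class \<open>C\<^sub>i\<close> is the set of jobs labelled \<open>i\<close>.\<close>

record batch_instance =
  nmachines :: nat
  njobs :: nat
  nclasses :: nat
  stime :: "nat \<Rightarrow> nat"
  ptime :: "nat \<Rightarrow> nat"
  cls :: "nat \<Rightarrow> nat"

definition class_jobs :: "batch_instance \<Rightarrow> nat \<Rightarrow> nat set" where
  "class_jobs I i = {j. j < njobs I \<and> cls I j = i}"

definition valid_instance :: "batch_instance \<Rightarrow> bool" where
  "valid_instance I \<longleftrightarrow>
     nmachines I \<ge> 1 \<and>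
     (\<forall>j<njobs I. ptime I j \<ge> 1 \<and> cls I j < nclasses I) \<and>
     (\<forall>i<nclasses I. stime I i \<ge> 1 \<and> class_jobs I i \<noteq> {})"


section \<open>Schedules\<close>

text \<open>\<open>Setup i a\<close> is a setup of class \<open>i\<close> that starts at time \<open>a\<close> (and, being unpreemptable, occupies
  the machine for exactly \<open>stime I i\<close>); \<open>Piece j a b\<close> processes job \<open>j\<close> during the time interval from \<open>a\<close> to \<open>b\<close>.
  A machine is the list of its items in chronological order, a schedule the list of all machines.\<close>

datatype 't item = Setup nat 't | Piece nat 't 't

type_synonym schedule = "real item list list"

fun is_piece :: "'t item \<Rightarrow> bool" where
  "is_piece (Setup i a) = False"
| "is_piece (Piece j a b) = True"

fun item_start :: "'t item \<Rightarrow> 't" where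
  "item_start (Setup i a) = a"
| "item_start (Piece j a b) = a"

fun item_end :: "batch_instance \<Rightarrow> real item \<Rightarrow> real" where
  "item_end I (Setup i a) = a + real (stime I i)"
| "item_end I (Piece j a b) = b"

fun item_class :: "batch_instance \<Rightarrow> 't item \<Rightarrow> nat" where
  "item_class I (Setup i a) = i"
| "item_class I (Piece j a b) = cls I j"

fun item_ok :: "batch_instance \<Rightarrow> real item \<Rightarrow> bool" where
  "item_ok I (Setup i a) \<longleftrightarrow> i < nclasses I \<and> 0 \<le> a"
| "item_ok I (Piece j a b) \<longleftrightarrow> j < njobs I \<and> 0 \<le> a \<and> a < b"

text \<open>The last condition is the setup rule: the item before a piece of class \<open>i\<close> is a setup of
  class \<open>i\<close> or another piece of class \<open>i\<close> (idle time in between is allowed), so every maximal run of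
  load of class \<open>i\<close> is opened by a setup of class \<open>i\<close>.\<close>

definition machine_ok :: "batch_instance \<Rightarrow> real item list \<Rightarrow> bool" where
  "machine_ok I xs \<longleftrightarrow>
     (\<forall>x\<in>set xs. item_ok I x) \<and>
     sorted_wrt (\<lambda>x y. item_end I x \<le> item_start y) xs \<and>
     (\<forall>k<length xs. is_piece (xs ! k) \<longrightarrow>
        k > 0 \<and> item_class I (xs ! (k - 1)) = item_class I (xs ! k))"

fun item_intervals :: "nat \<Rightarrow> 't item \<Rightarrow> ('t \<times> 't) list" where
  "item_intervals j (Setup i a) = []"
| "item_intervals j (Piece j' a b) = (if j' = j then [(a, b)] else [])"

definition job_intervals :: "schedule \<Rightarrow> nat \<Rightarrow> (real \<times> real) list" where
  "job_intervals S j = concat (map (item_intervals j) (concat S))"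

datatype variant = Nonpreemptive | Preemptive | Splittable

fun variant_ok :: "variant \<Rightarrow> (real \<times> real) list \<Rightarrow> bool" where
  "variant_ok Nonpreemptive ps \<longleftrightarrow> length ps = 1"
| "variant_ok Preemptive ps \<longleftrightarrow> sorted_wrt (\<lambda>p q. snd p \<le> fst q \<or> snd q \<le> fst p) ps"
| "variant_ok Splittable ps \<longleftrightarrow> True"

definition feasible :: "variant \<Rightarrow> batch_instance \<Rightarrow> schedule \<Rightarrow> bool" where
  "feasible v I S \<longleftrightarrow>
     length S = nmachines I \<and>
     (\<forall>xs\<in>set S. machine_ok I xs) \<and>
     (\<forall>j<njobs I. (\<Sum>(a, b)\<leftarrow>job_intervals S j. b - a) = real (ptime I j) \<and>
                  variant_ok v (job_intervals S j))"

definition makespan :: "batch_instance \<Rightarrow> schedule \<Rightarrow> real" where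
  "makespan I S = Max (insert 0 (item_end I ` set (concat S)))"

definition OPT :: "variant \<Rightarrow> batch_instance \<Rightarrow> real" where
  "OPT v I = (INF S\<in>{S. feasible v I S}. makespan I S)"


section \<open>The model of computation: a word RAM\<close>

text \<open>Programs are finite while-programs over number registers, a random access memory and a
  write-only output tape. Every operation has unit cost, so evaluating an expression
  costs its number of nodes.\<close>

datatype binop = Add | Sub | Mul | Div | Less | Equal

fun apply_binop :: "binop \<Rightarrow> nat \<Rightarrow> nat \<Rightarrow> nat" where
  "apply_binop Add x y = x + y"
| "apply_binop Sub x y = x - y"
| "apply_binop Mul x y = x * y"
| "apply_binop Div x y = x div y"
| "apply_binop Less x y = (if x < y then 1 else 0)"
| "apply_binop Equal x y = (if x = y then 1 else 0)"

datatype expr = Const nat | Reg nat | Mem expr | Bin binop expr expr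

datatype prog =
    Skip
  | Assign nat expr
  | Store expr expr  \<comment> \<open>address and value\<close>
  | Output expr
  | Seq prog prog
  | If expr prog prog
  | While expr prog

record ram_state =
  regs :: "nat \<Rightarrow> nat"
  mem :: "nat \<Rightarrow> nat"
  out :: "nat list"

fun eval :: "ram_state \<Rightarrow> expr \<Rightarrow> nat" where
  "eval s (Const k) = k"
| "eval s (Reg r) = regs s r"
| "eval s (Mem e) = mem s (eval s e)"
| "eval s (Bin f e1 e2) = apply_binop f (eval s e1) (eval s e2)"

fun cost :: "expr \<Rightarrow> nat" where
  "cost (Const k) = 1"
| "cost (Reg r) = 1"
| "cost (Mem e) = 1 + cost e"
| "cost (Bin f e1 e2) = 1 + cost e1 + cost e2"

text \<open>All values that occur in the evaluation, addresses and intermediate results included, are at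
  most \<open>W\<close>.\<close>

fun fits :: "nat \<Rightarrow> ram_state \<Rightarrow> expr \<Rightarrow> bool" where
  "fits W s (Const k) \<longleftrightarrow> k \<le> W"
| "fits W s (Reg r) \<longleftrightarrow> regs s r \<le> W"
| "fits W s (Mem e) \<longleftrightarrow> fits W s e \<and> mem s (eval s e) \<le> W"
| "fits W s (Bin f e1 e2) \<longleftrightarrow>
     fits W s e1 \<and> fits W s e2 \<and> apply_binop f (eval s e1) (eval s e2) \<le> W"

text \<open>\<open>exec W p s t s'\<close>: started in \<open>s\<close>, the program \<open>p\<close> halts in \<open>s'\<close> after \<open>t\<close> steps. A computation that
  exceeds the word bound \<open>W\<close> gets stuck and has no halting run.\<close>

inductive exec :: "nat \<Rightarrow> prog \<Rightarrow> ram_state \<Rightarrow> nat \<Rightarrow> ram_state \<Rightarrow> bool" for W :: nat where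
  Skip: "exec W Skip s 1 s"
| Assign: "fits W s e \<Longrightarrow>
    exec W (Assign r e) s (1 + cost e) (s\<lparr>regs := (regs s)(r := eval s e)\<rparr>)"
| Store: "fits W s e1 \<Longrightarrow> fits W s e2 \<Longrightarrow>
    exec W (Store e1 e2) s (1 + cost e1 + cost e2)
      (s\<lparr>mem := (mem s)(eval s e1 := eval s e2)\<rparr>)"
| Output: "fits W s e \<Longrightarrow> exec W (Output e) s (1 + cost e) (s\<lparr>out := out s @ [eval s e]\<rparr>)"
| Seq: "exec W p s t s' \<Longrightarrow> exec W q s' t' s'' \<Longrightarrow> exec W (Seq p q) s (t + t') s''"
| IfTrue: "fits W s e \<Longrightarrow> eval s e \<noteq> 0 \<Longrightarrow> exec W p s t s' \<Longrightarrow>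
    exec W (If e p q) s (1 + cost e + t) s'"
| IfFalse: "fits W s e \<Longrightarrow> eval s e = 0 \<Longrightarrow> exec W q s t s' \<Longrightarrow>
    exec W (If e p q) s (1 + cost e + t) s'"
| WhileFalse: "fits W s e \<Longrightarrow> eval s e = 0 \<Longrightarrow> exec W (While e p) s (1 + cost e) s"
| WhileTrue: "fits W s e \<Longrightarrow> eval s e \<noteq> 0 \<Longrightarrow> exec W p s t s' \<Longrightarrow>
    exec W (While e p) s' t' s'' \<Longrightarrow> exec W (While e p) s (1 + cost e + t + t') s''"

inductive_cases exec_SkipE: "exec W Skip s t s'"
inductive_cases exec_AssignE: "exec W (Assign r e) s t s'"
inductive_cases exec_StoreE: "exec W (Store e1 e2) s t s'"
inductive_cases exec_OutputE: "exec W (Output e) s t s'"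
inductive_cases exec_SeqE: "exec W (Seq p q) s t s'"
inductive_cases exec_IfE: "exec W (If e p q) s t s'"
inductive_cases exec_WhileE: "exec W (While e p) s t s'"

lemma exec_deterministic:
  "exec W p s t s' \<Longrightarrow> exec W p s u s'' \<Longrightarrow> t = u \<and> s' = s''"
proof (induction arbitrary: u s'' rule: exec.induct)
  case (Skip s)
  then show ?case by (rule exec_SkipE) simp
next
  case (Assign s e r)
  from Assign.prems show ?case by (rule exec_AssignE) simp
next
  case (Store s e1 e2)
  from Store.prems show ?case by (rule exec_StoreE) simp
next
  case (Output s e)
  from Output.prems show ?case by (rule exec_OutputE) simp
next
  case (Seq p s t s1 q t' s2)
  from Seq.prems show ?case
  proof (rule exec_SeqE)
    fix a b s0
    assume u: "u = a + b" and p: "exec W p s a s0" and q: "exec W q s0 b s''"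
    from Seq.IH(1)[OF p] have "t = a" "s1 = s0" by auto
    with Seq.IH(2)[of b s''] q u show ?thesis by simp
  qed
next
  case (IfTrue s e p t s' q)
  from IfTrue.prems show ?case
  proof (rule exec_IfE)
    fix a
    assume u: "u = Suc (cost e + a)" and p: "exec W p s a s''"
    from IfTrue.IH[OF p] u show ?thesis by simp
  qed (use IfTrue.hyps in simp)
next
  case (IfFalse s e q t s' p)
  from IfFalse.prems show ?case
  proof (rule exec_IfE)
    fix a
    assume u: "u = Suc (cost e + a)" and q: "exec W q s a s''"
    from IfFalse.IH[OF q] u show ?thesis by simp
  qed (use IfFalse.hyps in simp)
next
  case (WhileFalse s e p)
  from WhileFalse.prems show ?case by (rule exec_WhileE) (use WhileFalse.hyps in simp_all)
next
  case (WhileTrue s e p t s1 t' s2)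
  from WhileTrue.prems show ?case
  proof (rule exec_WhileE)
    fix a b s0
    assume u: "u = Suc (cost e + a + b)" and p: "exec W p s a s0"
      and q: "exec W (While e p) s0 b s''"
    from WhileTrue.IH(1)[OF p] have "t = a" "s1 = s0" by auto
    with WhileTrue.IH(2)[of b s''] q u show ?thesis by simp
  qed (use WhileTrue.hyps in simp)
qed

definition initial_state :: "nat list \<Rightarrow> ram_state" where
  "initial_state xs =
     \<lparr>regs = (\<lambda>_. 0), mem = (\<lambda>a. if a < length xs then xs ! a else 0), out = []\<rparr>"

text \<open>The word bound is polynomial in the input length and the largest input number, i.e. words have
  \<open>O(log (length + maximum))\<close> bits. This rules out the abuse of unit-cost multiplication on huge numbers.\<close>

definition word_bound :: "nat \<Rightarrow> nat list \<Rightarrow> nat" where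
  "word_bound \<kappa> xs = (length xs + Max (set xs)) ^ \<kappa>"

definition computes_in :: "prog \<Rightarrow> nat \<Rightarrow> nat list \<Rightarrow> nat \<Rightarrow> nat list \<Rightarrow> bool" where
  "computes_in p \<kappa> xs t ys \<longleftrightarrow>
     (\<exists>s'. exec (word_bound \<kappa> xs) p (initial_state xs) t s' \<and> out s' = ys)"


section \<open>Input and output formats\<close>

definition encode_instance :: "batch_instance \<Rightarrow> nat list" where
  "encode_instance I =
     [nmachines I, njobs I, nclasses I] @
     map (stime I) [0..<nclasses I] @ map (ptime I) [0..<njobs I] @ map (cls I) [0..<njobs I]"

text \<open>The output consists of a common denominator \<open>D\<close> of all points in time and a list of machine
  configurations with multiplicities, in which times are given by their numerators. Machines that are
  not listed are idle; hence the length of the output need not depend on the number of machines.\<close>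

type_synonym compact_schedule = "nat \<times> (nat \<times> nat item list) list"

definition listed_machines :: "compact_schedule \<Rightarrow> schedule" where
  "listed_machines K = (case K of (D, cs) \<Rightarrow>
     concat (map (\<lambda>(k, xs). replicate k (map (map_item (\<lambda>a. real a / real D)) xs)) cs))"

definition expand :: "batch_instance \<Rightarrow> compact_schedule \<Rightarrow> schedule" where
  "expand I K =
     listed_machines K @ replicate (nmachines I - length (listed_machines K)) []"

text \<open>Multiplicities other than 1 are only available in the splittable variant.\<close>

definition admissible_output :: "variant \<Rightarrow> compact_schedule \<Rightarrow> bool" where
  "admissible_output v K \<longleftrightarrow>
     fst K > 0 \<and> (v \<noteq> Splittable \<longrightarrow> (\<forall>(k, xs)\<in>set (snd K). k = 1))"

fun encode_item :: "nat item \<Rightarrow> nat list" where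
  "encode_item (Setup i a) = [1, i, a]"
| "encode_item (Piece j a b) = [2, j, a, b]"

fun encode_config :: "nat \<times> nat item list \<Rightarrow> nat list" where
  "encode_config (k, xs) = [0, k] @ concat (map encode_item xs)"

definition encode_schedule :: "compact_schedule \<Rightarrow> nat list" where
  "encode_schedule K = (case K of (D, cs) \<Rightarrow> D # concat (map encode_config cs))"

lemma encode_configs_head: "concat (map encode_config cs) = w # ws \<Longrightarrow> w = 0"
  by (cases cs) auto

lemma encode_items_inj:
  assumes "concat (map encode_item xs) @ concat (map encode_config cs)
         = concat (map encode_item ys) @ concat (map encode_config ds)"
  shows "xs = ys \<and> concat (map encode_config cs) = concat (map encode_config ds)"
  using assms
proof (induction xs arbitrary: ys)
  case Nil
  have "ys = []"
  proof (cases ys)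
    case (Cons y ys')
    obtain w ws where "encode_item y = w # ws" "w \<noteq> 0" by (cases y) simp_all
    with Nil Cons have "concat (map encode_config cs)
        = w # ws @ concat (map encode_item ys') @ concat (map encode_config ds)" by simp
    from encode_configs_head[OF this] \<open>w \<noteq> 0\<close> show ?thesis by simp
  qed
  with Nil show ?case by simp
next
  case (Cons x xs)
  have x: "\<exists>w ws. encode_item x = w # ws \<and> w \<noteq> 0" by (cases x) simp_all
  obtain y ys' where ys: "ys = y # ys'"
  proof (cases ys)
    case Nil
    from x obtain w ws where "encode_item x = w # ws" "w \<noteq> 0" by blast
    with Cons.prems Nil have "concat (map encode_config ds)
        = w # ws @ concat (map encode_item xs) @ concat (map encode_config cs)" by simp
    from encode_configs_head[OF this] \<open>w \<noteq> 0\<close> show ?thesis by simp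
  qed
  have eq: "encode_item x @ concat (map encode_item xs) @ concat (map encode_config cs)
      = encode_item y @ concat (map encode_item ys') @ concat (map encode_config ds)"
    using Cons.prems ys by simp
  have "x = y \<and> concat (map encode_item xs) @ concat (map encode_config cs)
      = concat (map encode_item ys') @ concat (map encode_config ds)"
    using eq by (cases x; cases y; simp)
  with Cons.IH[of ys'] ys show ?case by blast
qed

lemma encode_configs_inj:
  "concat (map encode_config cs) = concat (map encode_config ds) \<Longrightarrow> cs = ds"
proof (induction cs arbitrary: ds)
  case Nil
  then show ?case by (cases ds) auto
next
  case (Cons c cs)
  obtain k xs where c: "c = (k, xs)" by (cases c)
  from Cons.prems obtain d ds' where ds: "ds = d # ds'" by (cases ds) (auto simp: c)
  obtain l ys where d: "d = (l, ys)" by (cases d)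
  have "k = l" and eq: "concat (map encode_item xs) @ concat (map encode_config cs)
      = concat (map encode_item ys) @ concat (map encode_config ds')"
    using Cons.prems by (simp_all add: c d ds)
  with encode_items_inj[OF eq] Cons.IH[of ds'] show ?case by (simp add: c d ds)
qed

lemma inj_encode_schedule: "inj encode_schedule"
  by (auto simp: inj_def encode_schedule_def dest: encode_configs_inj)

end

theory Submission
  imports Defs
begin

text \<open>Let \<open>N\<close> be the total length of all setups and jobs, and let \<open>w\<close> be the maximum of \<open>s\<^sub>i\<close>, respectively
  of \<open>s\<^sub>i + t\<^sub>j\<close> if a job must not run in parallel with itself. Every schedule has makespan at least
  \<open>N / m\<close> and at least \<open>w\<close>. Write down all items class by class on a line and cut it into \<open>m\<close>
  segments of length \<open>N / m\<close>, one for each machine. A splittable job is cut at the borders of the segments;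
  otherwise a job goes as a whole to the segment in which it ends. In front of its segment a machine needs
  time for at most one repeated setup and one overhanging job, that is at most \<open>w\<close>, so the
  makespan is at most \<open>w + N / m\<close>. A schedule without any preemption thus also serves the
  preemptive variant. Multiplying all times by \<open>m\<close> makes them integers, and sorting the jobs into linked
  lists by class makes the time linear.\<close>

section \<open>Lower bounds on the optimum\<close>

text \<open>The algorithm exists twice: as a function \<open>handle\<close> that consumes one event,
  a class start or a job, and as a RAM program that simulates it, one loop iteration per event. The
  combinatorics is proved for \<open>handle\<close>, word bounds and step counts for the simulation.
  The obstacle is that the time must be linear in n while m may be arbitrarily large, so machines
  cannot be visited one by one. The segment of a piece is found by a single division of its end
  position, segments in which no piece ends are not listed, and the segments that one splittable job
  fills completely become one configuration with a multiplicity. The output tape is write-only; as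
  the line is processed from left to right, a new item either continues the last listed machine or
  opens a new one. A setup is not placed when its class starts but directly before the first piece
  of the class on a machine, so first and repeated setups are the same case.\<close>

definition item_len :: "batch_instance \<Rightarrow> real item \<Rightarrow> real" where
  "item_len I x = item_end I x - item_start x"

lemma item_ok_start_nonneg: "item_ok I x \<Longrightarrow> 0 \<le> item_start x"
  by (cases x) auto

lemma item_ok_start_le_end: "item_ok I x \<Longrightarrow> item_start x \<le> item_end I x"
  by (cases x) auto

lemma item_end_le_makespan: "x \<in> set (concat S) \<Longrightarrow> item_end I x \<le> makespan I S"
  unfolding makespan_def by (rule Max_ge) auto

lemma makespan_nonneg: "0 \<le> makespan I S"
  unfolding makespan_def by (rule Max_ge) auto

text \<open>The lower limit \<open>t\<close> is free in the induction: past the first item it moves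
  up to the end of that item, and idle time is only lost.\<close>

lemma sum_list_item_len_le:
  assumes "sorted_wrt (\<lambda>x y. item_end I x \<le> item_start y) xs"
    and "\<And>x. x \<in> set xs \<Longrightarrow> t \<le> item_start x \<and> item_start x \<le> item_end I x \<and> item_end I x \<le> M"
    and "t \<le> M"
  shows "sum_list (map (item_len I) xs) \<le> M - t"
  using assms
proof (induction xs arbitrary: t)
  case (Cons x xs)
  have "sum_list (map (item_len I) xs) \<le> M - item_end I x"
    using Cons.prems by (intro Cons.IH) auto
  moreover have "t \<le> item_start x" using Cons.prems by auto
  ultimately show ?case by (simp add: item_len_def[of I x])
qed simp

text \<open>The list follows the machines, not the clock, so the tail mixes intervals before and
  after the head. Those ending by the start of the head and the others, which by disjointness start
  no earlier than its end, are two shorter lists in two smaller windows.\<close>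

lemma sum_list_disjoint_intervals_le:
  fixes ps :: "(real \<times> real) list"
  assumes "sorted_wrt (\<lambda>p q. snd p \<le> fst q \<or> snd q \<le> fst p) ps"
    and "\<And>p. p \<in> set ps \<Longrightarrow> x \<le> fst p \<and> fst p < snd p \<and> snd p \<le> y"
    and "x \<le> y"
  shows "(\<Sum>(a, b)\<leftarrow>ps. b - a) \<le> y - x"
  using assms
proof (induction "length ps" arbitrary: ps x y rule: less_induct)
  case less
  show ?case
  proof (cases ps)
    case Nil
    with less.prems show ?thesis by simp
  next
    case (Cons p qs)
    obtain a b where p: "p = (a, b)" by (cases p)
    let ?A = "filter (\<lambda>q. snd q \<le> a) qs" and ?B = "filter (\<lambda>q. \<not> snd q \<le> a) qs"
    have ab: "x \<le> a" "a < b" "b \<le> y" using less.prems(2)[of p] Cons p by auto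
    have qs: "sorted_wrt (\<lambda>p q. snd p \<le> fst q \<or> snd q \<le> fst p) qs"
      "\<And>q. q \<in> set qs \<Longrightarrow> b \<le> fst q \<or> snd q \<le> a"
      using less.prems(1) Cons p by auto
    have lt: "length ?A < length ps" "length ?B < length ps"
      using Cons by (simp_all add: le_imp_less_Suc)
    have A: "(\<Sum>(a, b)\<leftarrow>?A. b - a) \<le> a - x"
      using less.prems(2) Cons qs ab by (intro less.hyps[OF lt(1)]) (auto intro: sorted_wrt_filter)
    have B: "(\<Sum>(a, b)\<leftarrow>?B. b - a) \<le> y - b"
      using less.prems(2) Cons qs ab by (intro less.hyps[OF lt(2)]) (auto intro: sorted_wrt_filter)
    have "(\<Sum>(a, b)\<leftarrow>qs. b - a) = (\<Sum>(a, b)\<leftarrow>?A. b - a) + (\<Sum>(a, b)\<leftarrow>?B. b - a)"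
      by (induction qs) auto
    with A B ab show ?thesis by (simp add: Cons p)
  qed
qed

section \<open>Setups in front of load, and the bounds by a single class or job\<close>

text \<open>A piece is never first on its machine, and its predecessor has the same class; walking
  back along pieces must therefore reach a setup of that class.\<close>

lemma opening_setup:
  assumes "machine_ok I xs" "k < length xs" "is_piece (xs ! k)"
  shows "\<exists>l<k. \<exists>a. xs ! l = Setup (item_class I (xs ! k)) a"
  using assms(2,3)
proof (induction k rule: less_induct)
  case (less k)
  have k: "k > 0" "item_class I (xs ! (k - 1)) = item_class I (xs ! k)"
    using assms(1) less.prems by (auto simp: machine_ok_def)
  show ?case
  proof (cases "is_piece (xs ! (k - 1))")
    case True
    with less.IH[of "k - 1"] less.prems k show ?thesis
      by (metis Suc_pred' less_SucI Suc_lessD lessI)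
  next
    case False
    then obtain i a where "xs ! (k - 1) = Setup i a" by (cases "xs ! (k - 1)") auto
    with k show ?thesis by (intro exI[of _ "k - 1"]) auto
  qed
qed

lemma setup_before_piece:
  assumes "machine_ok I xs" "Piece j a b \<in> set xs"
  shows "\<exists>a'. Setup (cls I j) a' \<in> set xs \<and> 0 \<le> a' \<and> a' + stime I (cls I j) \<le> a"
proof -
  from assms(2) obtain k where k: "k < length xs" "xs ! k = Piece j a b"
    by (auto simp: in_set_conv_nth)
  from opening_setup[OF assms(1) k(1)] k(2) obtain l a'
    where l: "l < k" "xs ! l = Setup (cls I j) a'" by auto
  have "Setup (cls I j) a' \<in> set xs" using l k by (metis nth_mem less_trans)
  moreover have "item_end I (xs ! l) \<le> item_start (xs ! k)"
    using assms(1) l(1) k(1) by (auto simp: machine_ok_def intro: sorted_wrt_nth_less)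
  ultimately show ?thesis
    using assms(1) l k by (auto simp: machine_ok_def intro!: exI[of _ a'])
qed

lemma set_job_intervals:
  "(a, b) \<in> set (job_intervals S j) \<longleftrightarrow> (\<exists>xs\<in>set S. Piece j a b \<in> set xs)"
proof -
  have "(a, b) \<in> set (item_intervals j x) \<longleftrightarrow> x = Piece j a b" for x :: "real item"
    by (cases x) auto
  then show ?thesis by (auto simp: job_intervals_def)
qed

lemma job_intervals_nonempty:
  assumes "feasible v I S" "valid_instance I" "j < njobs I"
  shows "job_intervals S j \<noteq> []"
proof
  assume "job_intervals S j = []"
  moreover have "(\<Sum>(a, b)\<leftarrow>job_intervals S j. b - a) = real (ptime I j)"
    using assms by (auto simp: feasible_def)
  ultimately show False using assms by (auto simp: valid_instance_def)
qed

text \<open>The class is nonempty and its jobs have positive length, so some piece of it is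
  scheduled, and a setup precedes that piece.\<close>

lemma ex_setup:
  assumes "feasible v I S" "valid_instance I" "i < nclasses I"
  shows "\<exists>a\<ge>0. Setup i a \<in> set (concat S)"
proof -
  from assms obtain j where j: "j < njobs I" "cls I j = i"
    by (auto simp: valid_instance_def class_jobs_def)
  from job_intervals_nonempty[OF assms(1,2) j(1)] obtain a b
    where "(a, b) \<in> set (job_intervals S j)" by (cases "job_intervals S j") auto
  then obtain xs where xs: "xs \<in> set S" "Piece j a b \<in> set xs"
    by (auto simp: set_job_intervals)
  then have "machine_ok I xs" using assms(1) by (auto simp: feasible_def)
  from setup_before_piece[OF this xs(2)] j xs(1) show ?thesis by auto
qed

lemma stime_le_makespan:
  assumes "feasible v I S" "valid_instance I" "i < nclasses I"
  shows "real (stime I i) \<le> makespan I S"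
proof -
  from ex_setup[OF assms] obtain a where "0 \<le> a" "Setup i a \<in> set (concat S)" by auto
  with item_end_le_makespan[of "Setup i a" S I] show ?thesis by simp
qed

text \<open>Every piece of \<open>j\<close> starts after a complete setup of its class. All pieces
  thus share the window from the setup time to the makespan, and in these variants they are disjoint
  there.\<close>

lemma stime_ptime_le_makespan:
  assumes "feasible v I S" "v \<noteq> Splittable" "valid_instance I" "j < njobs I"
  shows "real (stime I (cls I j) + ptime I j) \<le> makespan I S"
proof -
  let ?s = "real (stime I (cls I j))"
  have "variant_ok v (job_intervals S j)"
    and sum: "(\<Sum>(a, b)\<leftarrow>job_intervals S j. b - a) = real (ptime I j)"
    using assms by (auto simp: feasible_def)
  \<comment> \<open>In the non-preemptive case the list is a single interval, so one disjointness
    argument covers both variants.\<close>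
  then have disj: "sorted_wrt (\<lambda>p q. snd p \<le> fst q \<or> snd q \<le> fst p) (job_intervals S j)"
    using assms(2) by (cases v) (auto simp: length_Suc_conv)
  have "(\<Sum>(a, b)\<leftarrow>job_intervals S j. b - a) \<le> makespan I S - ?s"
  proof (rule sum_list_disjoint_intervals_le[OF disj])
    fix p assume p: "p \<in> set (job_intervals S j)"
    obtain a b where ab: "p = (a, b)" by (cases p)
    with p obtain xs where xs: "xs \<in> set S" "Piece j a b \<in> set xs"
      by (auto simp: set_job_intervals)
    then have ok: "machine_ok I xs" using assms(1) by (auto simp: feasible_def)
    have "item_ok I (Piece j a b)" using ok xs(2) unfolding machine_ok_def by blast
    moreover have "b \<le> makespan I S"
      using item_end_le_makespan[of "Piece j a b" S I] xs by auto
    ultimately show "?s \<le> fst p \<and> fst p < snd p \<and> snd p \<le> makespan I S"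
      using setup_before_piece[OF ok xs(2)] ab by auto
  next
    show "?s \<le> makespan I S"
      using assms by (intro stime_le_makespan) (auto simp: valid_instance_def)
  qed
  with sum show ?thesis by simp
qed

section \<open>The total load as a lower bound\<close>

fun setup_len :: "batch_instance \<Rightarrow> real item \<Rightarrow> real" where
  "setup_len I (Setup i a) = real (stime I i)"
| "setup_len I (Piece j a b) = 0"

fun piece_len :: "real item \<Rightarrow> real" where
  "piece_len (Setup i a) = 0"
| "piece_len (Piece j a b) = b - a"

lemma item_len_split: "item_len I x = setup_len I x + piece_len x"
  by (cases x) (auto simp: item_len_def)

lemma sum_set_le_sum_list:
  fixes f :: "'a \<Rightarrow> real"
  assumes "\<And>x. x \<in> set xs \<Longrightarrow> 0 \<le> f x"
  shows "sum f (set xs) \<le> sum_list (map f xs)"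
  using assms
proof (induction xs)
  case (Cons x xs)
  then have "sum f (set xs) \<le> sum_list (map f xs)" "0 \<le> f x" by auto
  then show ?case by (cases "x \<in> set xs") (auto simp: insert_absorb)
qed simp

text \<open>One setup is chosen per class. Different classes give different items, so the chosen
  ones form a subset of all items; the list may contain further or repeated setups and only weighs
  more.\<close>

lemma sum_stime_le:
  assumes "feasible v I S" "valid_instance I"
  shows "(\<Sum>i<nclasses I. real (stime I i)) \<le> sum_list (map (setup_len I) (concat S))"
proof -
  obtain a where a: "\<And>i. i < nclasses I \<Longrightarrow> Setup i (a i) \<in> set (concat S)"
    using ex_setup[OF assms] by metis
  have nonneg: "0 \<le> setup_len I x" for x by (cases x) auto
  have "(\<Sum>i<nclasses I. real (stime I i)) = sum (setup_len I) ((\<lambda>i. Setup i (a i)) ` {..<nclasses I})"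
    by (subst sum.reindex) (auto simp: inj_on_def)
  also have "\<dots> \<le> sum (setup_len I) (set (concat S))"
    using a nonneg by (intro sum_mono2) auto
  also have "\<dots> \<le> sum_list (map (setup_len I) (concat S))"
    using nonneg by (rule sum_set_le_sum_list)
  finally show ?thesis .
qed

text \<open>A piece is charged to the one job it processes; \<open>item_ok\<close> puts that job
  below \<open>njobs I\<close>, so no piece is lost.\<close>

lemma sum_piece_len:
  assumes "\<And>x. x \<in> set xs \<Longrightarrow> item_ok I x"
  shows "(\<Sum>j<njobs I. \<Sum>(a, b)\<leftarrow>concat (map (item_intervals j) xs). b - a)
    = sum_list (map piece_len xs)"
  using assms
proof (induction xs)
  case (Cons x xs)
  have "(\<Sum>j<njobs I. \<Sum>(a, b)\<leftarrow>item_intervals j x. b - a) = piece_len x"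
  proof (cases x)
    case (Piece j a b)
    with Cons.prems[of x] have "j < njobs I" by simp
    moreover have "(\<Sum>(a, b)\<leftarrow>item_intervals j' x. b - a) = (if j' = j then b - a else 0)" for j'
      by (simp add: Piece)
    ultimately show ?thesis by (simp add: Piece)
  qed simp
  with Cons show ?case by (simp add: sum.distrib)
qed simp

lemma load_le_makespan:
  assumes "feasible v I S" "valid_instance I"
  shows "real ((\<Sum>i<nclasses I. stime I i) + (\<Sum>j<njobs I. ptime I j))
    \<le> real (nmachines I) * makespan I S"
proof -
  have ok: "machine_ok I xs" if "xs \<in> set S" for xs
    using assms that by (auto simp: feasible_def)
  have "(\<Sum>j<njobs I. real (ptime I j)) = (\<Sum>j<njobs I. \<Sum>(a, b)\<leftarrow>job_intervals S j. b - a)"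
    using assms by (intro sum.cong) (auto simp: feasible_def)
  also have "\<dots> = sum_list (map piece_len (concat S))"
    unfolding job_intervals_def
    by (rule sum_piece_len) (use ok in \<open>auto simp: machine_ok_def\<close>)
  finally have "(\<Sum>i<nclasses I. real (stime I i)) + (\<Sum>j<njobs I. real (ptime I j))
      \<le> sum_list (map (setup_len I) (concat S)) + sum_list (map piece_len (concat S))"
    using sum_stime_le[OF assms] by simp
  also have "\<dots> = sum_list (map (item_len I) (concat S))"
    by (simp add: item_len_split[abs_def] sum_list_addf)
  also have "\<dots> = (\<Sum>xs\<leftarrow>S. sum_list (map (item_len I) xs))"
    by (induction S) auto
  also have "\<dots> \<le> (\<Sum>xs\<leftarrow>S. makespan I S)"
  proof (rule sum_list_mono)
    fix xs assume xs: "xs \<in> set S"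
    have "sum_list (map (item_len I) xs) \<le> makespan I S - 0"
      using ok[OF xs] xs item_end_le_makespan[of _ S I]
      by (intro sum_list_item_len_le)
        (auto simp: machine_ok_def makespan_nonneg item_ok_start_nonneg item_ok_start_le_end)
    then show "sum_list (map (item_len I) xs) \<le> makespan I S" by simp
  qed
  also have "\<dots> = real (nmachines I) * makespan I S"
    using assms(1) by (simp add: feasible_def sum_list_triv)
  finally show ?thesis by simp
qed

section \<open>Wrapping the jobs around the machines\<close>

lemma machine_ok_snoc_setup:
  assumes "machine_ok I xs" "i < nclasses I" "0 \<le> a" "\<And>x. x \<in> set xs \<Longrightarrow> item_end I x \<le> a"
  shows "machine_ok I (xs @ [Setup i a])"
  using assms by (auto simp: machine_ok_def sorted_wrt_append nth_append less_Suc_eq)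

lemma machine_ok_snoc_piece:
  assumes "machine_ok I xs" "xs \<noteq> []" "item_class I (last xs) = cls I j" "j < njobs I"
    "0 \<le> a" "a < b" "\<And>x. x \<in> set xs \<Longrightarrow> item_end I x \<le> a"
  shows "machine_ok I (xs @ [Piece j a b])"
  using assms by (auto simp: machine_ok_def sorted_wrt_append nth_append less_Suc_eq last_conv_nth)

lemma machine_ok_Nil: "machine_ok I []"
  by (simp add: machine_ok_def)

section \<open>The functional scheduler\<close>

datatype event = Start nat | Job nat

text \<open>\<open>used\<close> is one more than the index of the last listed segment, counting
  skipped segments, and 0 if there is none. \<open>fresh\<close> records that a class has started
  since the last piece was placed, so its setup is still missing.\<close>

record sched =
  pos :: nat
  used :: nat
  fresh :: bool
  cur :: nat
  confs :: "(nat \<times> nat item list) list"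

definition extend_last :: "(nat \<times> nat item list) list \<Rightarrow> nat item list \<Rightarrow> (nat \<times> nat item list) list" where
  "extend_last cs xs = butlast cs @ [(fst (last cs), snd (last cs) @ xs)]"

locale batch =
  fixes I :: batch_instance and v :: variant
  assumes valid: "valid_instance I"
begin

abbreviation "m \<equiv> nmachines I"
abbreviation "n \<equiv> njobs I"
abbreviation "c \<equiv> nclasses I"

definition load :: nat where
  "load = (\<Sum>i<c. stime I i) + (\<Sum>j<n. ptime I j)"

definition width :: "nat \<Rightarrow> nat" where
  "width j = stime I (cls I j) + (if v = Splittable then 0 else ptime I j)"

definition base :: nat where
  "base = m * Max (insert 0 (width ` {..<n}))"

lemma m_pos: "0 < m"
  using valid by (auto simp: valid_instance_def)

lemma class_less: "j < n \<Longrightarrow> cls I j < c"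
  using valid by (auto simp: valid_instance_def)

lemma ptime_pos: "j < n \<Longrightarrow> 0 < ptime I j"
  using valid by (auto simp: valid_instance_def)

lemma width_le_base: "j < n \<Longrightarrow> m * width j \<le> base"
  unfolding base_def by (intro mult_le_mono2 Max_ge) auto

text \<open>With all times multiplied by \<open>m\<close>, the segment of machine \<open>u\<close> consists of the positions from
  \<open>u * load\<close> to \<open>(u + 1) * load\<close>, and position \<open>x\<close> becomes the time \<open>base + x - u * load\<close> on that
  machine. A multiplicity \<open>k > 1\<close> stands for \<open>k\<close> consecutive machines.\<close>

definition emit :: "nat \<Rightarrow> nat \<Rightarrow> nat \<Rightarrow> sched \<Rightarrow> sched" where
  "emit j k len st =
    (let u = (pos st + len - 1) div load;
         a = base + pos st - u * load;
         new = (u + 1 \<noteq> used st);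
         xs = (if fresh st \<or> new then [Setup (cur st) (a - m * stime I (cur st))] else [])
              @ [Piece j a (a + len)]
     in st\<lparr>pos := pos st + k * len, used := u + k, fresh := False,
           confs := (if new then confs st @ [(k, xs)] else extend_last (confs st) xs)\<rparr>)"

text \<open>A splittable job that begins on a border has \<open>pos st mod load = 0\<close>, so its
  first cut may already be an entire segment. All further full segments are collected in one
  multiplicity, so at most three pieces are emitted per job.\<close>

fun handle :: "event \<Rightarrow> sched \<Rightarrow> sched" where
  "handle (Start i) st = st\<lparr>pos := pos st + m * stime I i, fresh := True, cur := i\<rparr>"
| "handle (Job j) st =
    (if v = Splittable then
       let q = pos st + m * ptime I j;
           st1 = emit j 1 (min (q - pos st) (load - pos st mod load)) st;
           st2 = (if 0 < (q - pos st1) div load then emit j ((q - pos st1) div load) load st1 else st1)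
       in if pos st2 < q then emit j 1 (q - pos st2) st2 else st2
     else emit j 1 (m * ptime I j) st)"

fun event_width :: "event \<Rightarrow> nat" where
  "event_width (Start i) = m * stime I i"
| "event_width (Job j) = m * ptime I j"

fun admissible_events :: "nat \<Rightarrow> event list \<Rightarrow> bool" where
  "admissible_events i [] \<longleftrightarrow> True"
| "admissible_events i (Start i' # es) \<longleftrightarrow> i' < c \<and> admissible_events i' es"
| "admissible_events i (Job j # es) \<longleftrightarrow> j < n \<and> cls I j = i \<and> admissible_events i es"

section \<open>Correct configurations and the invariant\<close>

definition scaled :: "nat item list \<Rightarrow> real item list" where
  "scaled xs = map (map_item (\<lambda>a. real a / real m)) xs"

definition conf_ok :: "nat \<Rightarrow> nat item list \<Rightarrow> bool" where
  "conf_ok e xs \<longleftrightarrow> machine_ok I (scaled xs) \<and>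
     (\<forall>x\<in>set (scaled xs). item_end I x \<le> real e / real m)"

lemma conf_ok_mono: "conf_ok e xs \<Longrightarrow> e \<le> e' \<Longrightarrow> conf_ok e' xs"
  unfolding conf_ok_def
  by (meson divide_right_mono of_nat_0_le_iff of_nat_mono order_trans)

text \<open>The setup is right-aligned: it ends exactly at \<open>a\<close>, where the next piece is
  to begin.\<close>

lemma conf_ok_snoc_setup:
  assumes "conf_ok e xs" "i < c" "e + m * stime I i \<le> a"
  shows "conf_ok a (xs @ [Setup i (a - m * stime I i)])"
proof -
  have "e \<le> a - m * stime I i" using assms by simp
  then have e: "real e / m \<le> real (a - m * stime I i) / m"
    by (intro divide_right_mono of_nat_mono) auto
  have "real (a - m * stime I i) / m + stime I i = real a / m"
    using assms m_pos by (simp add: field_simps of_nat_diff)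
  moreover have "real e / m \<le> real a / m"
    using assms by (intro divide_right_mono) auto
  moreover have "machine_ok I (scaled xs @ [Setup i (real (a - m * stime I i) / m)])"
    using assms(1,2) e by (intro machine_ok_snoc_setup) (force simp: conf_ok_def simp del: of_nat_diff)+
  ultimately show ?thesis
    using assms(1) unfolding conf_ok_def scaled_def by auto
qed

lemma conf_ok_snoc_piece:
  assumes "conf_ok a xs" "xs \<noteq> []" "item_class I (last xs) = cls I j" "j < n" "0 < len"
  shows "conf_ok (a + len) (xs @ [Piece j a (a + len)])"
proof -
  have [simp]: "item_class I (map_item f x) = item_class I x" for f :: "nat \<Rightarrow> real" and x
    by (cases x) auto
  have "real a / m < real (a + len) / m"
    using assms m_pos by (intro divide_strict_right_mono) auto
  moreover have "conf_ok (a + len) xs"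
    using assms(1) by (rule conf_ok_mono) simp
  ultimately show ?thesis
    using assms by (auto simp: conf_ok_def scaled_def last_map intro!: machine_ok_snoc_piece)
qed

lemma conf_ok_Nil: "conf_ok e []"
  by (simp add: conf_ok_def scaled_def machine_ok_Nil)

text \<open>\<open>e\<close> is the position up to which the last listed machine is filled.\<close>

definition inv_at :: "nat \<Rightarrow> sched \<Rightarrow> bool" where
  "inv_at e st \<longleftrightarrow>
     e \<le> pos st \<and> (fresh st \<longrightarrow> e + m * stime I (cur st) \<le> pos st) \<and>
     (used st = 0 \<longleftrightarrow> confs st = []) \<and>
     (0 < used st \<longrightarrow> (used st - 1) * load < e \<and> e \<le> used st * load) \<and>
     sum_list (map fst (confs st)) \<le> used st \<and>
     (\<forall>k xs. (k, xs) \<in> set (confs st) \<longrightarrow> conf_ok (base + load) xs) \<and>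
     (v \<noteq> Splittable \<longrightarrow> (\<forall>k xs. (k, xs) \<in> set (confs st) \<longrightarrow> k = 1)) \<and>
     (confs st \<noteq> [] \<longrightarrow>
        conf_ok (base + e - (used st - 1) * load) (snd (last (confs st))) \<and>
        (fst (last (confs st)) = 1 \<or> used st * load \<le> pos st) \<and>
        snd (last (confs st)) \<noteq> [] \<and>
        (\<not> fresh st \<longrightarrow> item_class I (last (snd (last (confs st)))) = cur st))"

text \<open>The filled position is a ghost value: a class start moves \<open>pos\<close> but fills
  no machine, and the scheduler need not remember where the last piece ended.\<close>

definition inv :: "sched \<Rightarrow> bool" where
  "inv st \<longleftrightarrow> (\<exists>e. inv_at e st)"

text \<open>The weight \<open>h\<close> is a parameter so that one argument serves two purposes:
  \<open>b - a\<close> measures the processed amount of a job, and the constant 1 counts its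
  pieces.\<close>

definition job_measure :: "(real \<times> real \<Rightarrow> real) \<Rightarrow> nat \<Rightarrow> (nat \<times> nat item list) list \<Rightarrow> real" where
  "job_measure h j cs =
     (\<Sum>(k, xs)\<leftarrow>cs. real k * (\<Sum>x\<leftarrow>scaled xs. \<Sum>p\<leftarrow>item_intervals j x. h p))"

lemma job_measure_append:
  "job_measure h j (cs @ ds) = job_measure h j cs + job_measure h j ds"
  by (simp add: job_measure_def)

lemma job_measure_extend_last:
  assumes "cs \<noteq> []" "fst (last cs) = 1"
  shows "job_measure h j (extend_last cs xs) = job_measure h j (cs @ [(1, xs)])"
proof -
  obtain ys where ys: "last cs = (1, ys)" using assms(2) by (cases "last cs") auto
  with assms(1) have "cs = butlast cs @ [(1, ys)]" by (metis append_butlast_last_id)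
  then have "job_measure h j cs = job_measure h j (butlast cs) + job_measure h j [(1, ys)]"
    by (metis job_measure_append)
  then show ?thesis
    using ys by (simp add: extend_last_def job_measure_append job_measure_def scaled_def)
qed

text \<open>The inequality says that the piece starts no earlier than the scaled setup time. Hence
  neither start time computed in \<open>emit\<close> is cut off by truncated subtraction. The last
  conjunct admits multiplicities only for pieces that fill segments from border to border.\<close>

definition emit_pre :: "nat \<Rightarrow> nat \<Rightarrow> nat \<Rightarrow> sched \<Rightarrow> bool" where
  "emit_pre j k len st \<longleftrightarrow> j < n \<and> cls I j = cur st \<and> 0 < k \<and> 0 < len \<and>
     m * stime I (cur st) + (pos st + len - 1) div load * load \<le> base + pos st \<and>
     (k = 1 \<or> v = Splittable \<and> load dvd pos st \<and> len = load)"

text \<open>In a new segment the machine opens with setup and piece. Otherwise the last listed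
  machine is continued: within a segment, times and positions differ by a constant, and if the class
  is fresh, its start has moved \<open>pos\<close> past the filled position by the length of the
  setup that has to go in between.\<close>

lemma emit_inv:
  assumes inv: "inv st" and pre: "emit_pre j k len st" and load: "0 < load"
  shows "inv (emit j k len st)"
    and "\<exists>a. \<forall>h j'. job_measure h j' (confs (emit j k len st)) = job_measure h j' (confs st) +
       (if j' = j then real k * h (real a / real m, real (a + len) / real m) else 0)"
proof -
  from inv obtain e where inv: "inv_at e st" by (auto simp: inv_def)
  define u where "u = (pos st + len - 1) div load"
  define a where "a = base + pos st - u * load"
  define new where "new \<longleftrightarrow> u + 1 \<noteq> used st"
  define su where "su = (if fresh st \<or> new then [Setup (cur st) (a - m * stime I (cur st))] else [])"
  define xs where "xs = su @ [Piece j a (a + len)]"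
  have emit: "emit j k len st = st\<lparr>pos := pos st + k * len, used := u + k, fresh := False,
      confs := (if new then confs st @ [(k, xs)] else extend_last (confs st) xs)\<rparr>"
    by (simp add: emit_def Let_def u_def a_def new_def xs_def su_def)
  have j: "j < n" "cls I j = cur st" and kl: "0 < k" "0 < len" using pre by (auto simp: emit_pre_def)
  have cur: "cur st < c" using class_less[OF j(1)] j by simp
  have room: "m * stime I (cur st) + u * load \<le> base + pos st"
    using pre by (simp add: emit_pre_def u_def)
  \<comment> \<open>Because of the subtracted 1 the segments are open on the left and closed on the
    right: a piece ending on a border belongs to the segment before that border.\<close>
  have u1: "u * load < pos st + len"
    using kl div_times_less_eq_dividend[of "pos st + len - 1" load] unfolding u_def by linarith
  have u2: "pos st + len \<le> (u + 1) * load"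
    using kl dividend_less_times_div[OF load, of "pos st + len - 1"]
    unfolding u_def by (simp add: algebra_simps)
  \<comment> \<open>A multiplicity above 1 forces \<open>len = load\<close>, so every copy after the
    first adds one whole segment.\<close>
  have end_pos: "pos st + k * len = pos st + len + (k - 1) * load"
    using pre kl by (cases k) (auto simp: emit_pre_def)
  have end1: "(u + k - 1) * load < pos st + k * len"
    unfolding end_pos using u1 kl by (cases k) (simp_all add: algebra_simps)
  have end2: "pos st + k * len \<le> (u + k) * load"
    unfolding end_pos using u2 kl by (cases k) (simp_all add: algebra_simps)
  have end3: "base + (pos st + k * len) - (u + k - 1) * load = a + len"
    unfolding end_pos using room kl by (cases k) (simp_all add: a_def algebra_simps)
  have a: "m * stime I (cur st) \<le> a" "a + len \<le> base + load"
    using room u2 by (auto simp: a_def algebra_simps)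
  have e: "e \<le> pos st" "fresh st \<longrightarrow> e + m * stime I (cur st) \<le> pos st"
    using inv by (auto simp: inv_at_def)
  \<comment> \<open>The filled position never exceeds \<open>pos\<close>, so the last listed segment
    cannot lie beyond the one in which the piece ends.\<close>
  have used_le: "used st \<le> u + 1"
  proof (cases "used st = 0")
    case False
    then have "(used st - 1) * load < (u + 1) * load"
      using inv e u1 u2 kl by (simp add: inv_at_def)
    then have "used st - 1 < u + 1" by (simp only: mult_less_cancel2)
    then show ?thesis by simp
  qed simp
  have mult: "k = 1" if "v \<noteq> Splittable" using pre that by (auto simp: emit_pre_def)
  have pos_u: "pos st = u * load" if "k \<noteq> 1"
  proof -
    from that pre obtain r where r: "pos st = r * load" "len = load"
      by (auto simp: emit_pre_def elim!: dvdE)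
    then have "pos st + len - 1 = (load - 1) + r * load" using load by simp
    then have "u = ((load - 1) + r * load) div load" by (simp only: u_def)
    also have "\<dots> = r" using load by (subst div_mult_self1) simp_all
    finally show ?thesis using r by simp
  qed
  \<comment> \<open>A multiple piece starts on the left border of segment \<open>u\<close>, and
    nothing is filled past \<open>pos\<close>; an already listed segment \<open>u\<close> would be
    filled strictly past that border.\<close>
  have k1: "k = 1" if "\<not> new"
  proof (rule ccontr)
    assume "k \<noteq> 1"
    then have "pos st = u * load" by (rule pos_u)
    moreover have "used st - 1 = u" "(used st - 1) * load < e"
      using that inv by (simp_all add: new_def inv_at_def)
    ultimately show False using e by simp
  qed
  have ne: "confs st \<noteq> []" if "\<not> new" using that inv by (auto simp: new_def inv_at_def)
  \<comment> \<open>If the last multiplicity were not 1, \<open>pos\<close> would have reached the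
    right border of the last segment, but the piece starts strictly before it.\<close>
  have single: "fst (last (confs st)) = 1" if "\<not> new"
    using that inv ne[OF that] u1 u2 kl by (auto simp: new_def inv_at_def)
  show "inv (emit j k len st)"
  proof (cases new)
    case True
    have ok: "conf_ok (a + len) xs"
      using conf_ok_snoc_piece[OF conf_ok_snoc_setup[OF conf_ok_Nil, of "cur st" 0 a], of j len]
        True j kl cur a by (simp add: xs_def su_def)
    moreover from ok a have "conf_ok (base + load) xs" by (blast intro: conf_ok_mono)
    moreover have "used st \<le> u" using used_le True by (simp add: new_def)
    moreover have "k = 1 \<or> (u + k) * load \<le> pos st + k * len"
    proof (cases "k = 1")
      case False
      with pre have "len = load" by (simp add: emit_pre_def)
      with pos_u[OF False] show ?thesis by (simp add: algebra_simps)
    qed simp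
    ultimately have "inv_at (pos st + k * len) (emit j k len st)"
      using inv True end1 end2 end3 kl j mult
      unfolding emit inv_at_def by (auto simp: xs_def)
    then show ?thesis by (auto simp: inv_def)
  next
    case same: False
    note k1 = k1[OF same] and single = single[OF same] and ne = ne[OF same]
    from same have used: "used st = u + 1" by (simp add: new_def)
    with k1 single ne inv have last_ok: "conf_ok (base + e - u * load) (snd (last (confs st)))"
      "snd (last (confs st)) \<noteq> []"
      "\<not> fresh st \<longrightarrow> item_class I (last (snd (last (confs st)))) = cur st"
      by (auto simp: inv_at_def)
    have ok1: "conf_ok a (snd (last (confs st)) @ su)"
    proof (cases "fresh st")
      case True
      have "base + e - u * load + m * stime I (cur st) \<le> a"
        using room e True by (auto simp: a_def)
      with conf_ok_snoc_setup[OF last_ok(1) cur this] True show ?thesis by (simp add: su_def)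
    next
      case False
      have "base + e - u * load \<le> a" using e by (auto simp: a_def)
      with conf_ok_mono[OF last_ok(1) this] False same show ?thesis by (simp add: su_def)
    qed
    have "item_class I (last (snd (last (confs st)) @ su)) = cls I j"
      using last_ok j same by (auto simp: su_def)
    with conf_ok_snoc_piece[OF ok1] j kl last_ok(2)
    have ok: "conf_ok (a + len) (snd (last (confs st)) @ xs)"
      by (simp add: xs_def)
    from ok a have all_ok: "conf_ok (base + load) (snd (last (confs st)) @ xs)"
      by (blast intro: conf_ok_mono)
    have sum_eq: "sum_list (map fst (confs st)) = sum_list (map fst (extend_last (confs st) xs))"
      using ne by (cases "confs st" rule: rev_cases) (auto simp: extend_last_def)
    have sub: "set (extend_last (confs st) xs)
        \<subseteq> insert (1, snd (last (confs st)) @ xs) (set (confs st))"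
      using single by (auto simp: extend_last_def dest: in_set_butlastD)
    have "\<forall>k ys. (k, ys) \<in> set (extend_last (confs st) xs) \<longrightarrow> conf_ok (base + load) ys"
      using sub all_ok inv unfolding inv_at_def by blast
    moreover have "v \<noteq> Splittable \<longrightarrow>
        (\<forall>k ys. (k, ys) \<in> set (extend_last (confs st) xs) \<longrightarrow> k = 1)"
      using sub inv unfolding inv_at_def by blast
    moreover have "extend_last (confs st) xs \<noteq> []"
      "last (extend_last (confs st) xs) = (1, snd (last (confs st)) @ xs)"
      using single by (auto simp: extend_last_def)
    ultimately have "inv_at (pos st + k * len) (emit j k len st)"
      using inv same end1 end2 end3 kl j mult k1 used sum_eq ok
      unfolding emit inv_at_def by (auto simp: xs_def)
    then show ?thesis by (auto simp: inv_def)
  qed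
  have measure: "job_measure h j' [(k, xs)] =
      (if j' = j then real k * h (real a / real m, real (a + len) / real m) else 0)" for h j'
    by (simp add: job_measure_def scaled_def xs_def su_def)
  show "\<exists>a. \<forall>h j'. job_measure h j' (confs (emit j k len st)) = job_measure h j' (confs st) +
       (if j' = j then real k * h (real a / real m, real (a + len) / real m) else 0)"
  proof (cases new)
    case True
    have "job_measure h j' (confs (emit j k len st))
        = job_measure h j' (confs st) + job_measure h j' [(k, xs)]" for h j'
      unfolding emit using True by (simp add: job_measure_append)
    then show ?thesis unfolding measure by blast
  next
    case False
    note k1 = k1[OF False] and single = single[OF False] and ne = ne[OF False]
    have "job_measure h j' (confs (emit j k len st))
        = job_measure h j' (confs st) + job_measure h j' [(k, xs)]" for h j'
      unfolding emit using job_measure_extend_last[OF ne single] False k1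
      by (simp add: job_measure_append)
    then show ?thesis unfolding measure by blast
  qed
qed

lemma emit_amount:
  assumes "inv st" "emit_pre j k len st" "0 < load"
  shows "job_measure (\<lambda>(a, b). b - a) j' (confs (emit j k len st))
    = job_measure (\<lambda>(a, b). b - a) j' (confs st) + (if j' = j then real (k * len) / real m else 0)"
proof -
  have "real (a + len) / real m - real a / real m = real len / real m" for a
    by (simp add: add_divide_distrib)
  then show ?thesis using emit_inv(2)[OF assms] by auto
qed

lemma emit_count:
  assumes "inv st" "emit_pre j 1 len st" "0 < load"
  shows "job_measure (\<lambda>_. 1) j' (confs (emit j 1 len st))
    = job_measure (\<lambda>_. 1) j' (confs st) + (if j' = j then 1 else 0)"
  using emit_inv(2)[OF assms] by auto

lemma emit_simps [simp]:
  "pos (emit j k len st) = pos st + k * len" "cur (emit j k len st) = cur st"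
  by (simp_all add: emit_def Let_def)

text \<open>\<open>load\<close> vanishes only without jobs, and then no piece and no division by
  \<open>load\<close> arises.\<close>

lemma load_pos: "j < n \<Longrightarrow> 0 < load"
  using ptime_pos[of j] member_le_sum[of j "{..<n}" "ptime I"] by (auto simp: load_def)

lemma handle_Start_inv:
  assumes "inv st"
  shows "inv (handle (Start i) st)"
proof -
  from assms obtain e where e: "inv_at e st" by (auto simp: inv_def)
  then have "inv_at e (handle (Start i) st)"
    by (simp add: inv_at_def) (blast intro: trans_le_add1)
  then show ?thesis by (auto simp: inv_def)
qed

text \<open>The job ends past the left border of its segment, so it overhangs that border by less
  than its own length, and \<open>base\<close> reserves setup and job together.\<close>

lemma emit_pre_whole:
  assumes "v \<noteq> Splittable" "j < n" "cls I j = cur st"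
  shows "emit_pre j 1 (m * ptime I j) st"
proof -
  have "(pos st + m * ptime I j - 1) div load * load \<le> pos st + m * ptime I j - 1"
    by (rule div_times_less_eq_dividend)
  moreover have "m * stime I (cur st) + m * ptime I j \<le> base"
    using width_le_base[OF assms(2)] assms by (simp add: width_def algebra_simps)
  moreover have "0 < m * ptime I j" using m_pos ptime_pos[OF assms(2)] by simp
  ultimately have "m * stime I (cur st) + (pos st + m * ptime I j - 1) div load * load
      \<le> base + pos st" by linarith
  with assms m_pos ptime_pos[OF assms(2)] show ?thesis by (simp add: emit_pre_def)
qed

text \<open>A piece that crosses no border begins and ends in the same segment: nothing overhangs,
  and the reserve only has to take the setup.\<close>

lemma emit_pre_within:
  assumes "v = Splittable" "j < n" "cls I j = cur st" "0 < k" "0 < len"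
    "len \<le> load - pos st mod load" "k = 1 \<or> load dvd pos st \<and> len = load"
  shows "emit_pre j k len st"
proof -
  have l: "0 < load" using load_pos assms by blast
  have "pos st mod load + (len - 1) < load" using assms l by (simp add: less_diff_conv)
  moreover have "pos st + len - 1 = pos st div load * load + (pos st mod load + (len - 1))"
    using assms(5) by simp
  ultimately have "(pos st + len - 1) div load = pos st div load"
    using l by (metis add.right_neutral div_less div_mult_self3 less_nat_zero_code)
  moreover have "pos st div load * load \<le> pos st" by (rule div_times_less_eq_dividend)
  moreover have "width j = stime I (cur st)" unfolding width_def using assms(1,3) by simp
  then have "m * stime I (cur st) \<le> base" using width_le_base[OF assms(2)] by simp
  ultimately show ?thesis using assms unfolding emit_pre_def by (simp add: add_mono)
qed

text \<open>The parts into which a splittable job is cut: up to the next border, across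
  \<open>k2\<close> entire machines, and the remainder.\<close>

lemma handle_Job_split:
  assumes "v = Splittable" "j < n" "cls I j = cur st"
  defines "q \<equiv> pos st + m * ptime I j"
  defines "len1 \<equiv> min (q - pos st) (load - pos st mod load)"
  defines "st1 \<equiv> emit j 1 len1 st"
  defines "k2 \<equiv> (q - pos st1) div load"
  defines "st2 \<equiv> (if 0 < k2 then emit j k2 load st1 else st1)"
  shows "handle (Job j) st = (if pos st2 < q then emit j 1 (q - pos st2) st2 else st2)"
    and "emit_pre j 1 len1 st"
    and "0 < k2 \<Longrightarrow> emit_pre j k2 load st1"
    and "pos st2 < q \<Longrightarrow> emit_pre j 1 (q - pos st2) st2"
    and "pos st1 \<le> q" and "pos st2 = pos st1 + k2 * load" and "pos st2 \<le> q"
proof -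
  have l: "0 < load" using load_pos assms by blast
  have q: "pos st < q" using m_pos ptime_pos[OF assms(2)] by (simp add: q_def)
  have ml: "pos st mod load < load" using l by simp
  have cur: "cur st1 = cur st" "cur st2 = cur st" by (simp_all add: st1_def st2_def)
  show "handle (Job j) st = (if pos st2 < q then emit j 1 (q - pos st2) st2 else st2)"
    unfolding handle.simps Let_def if_P[OF assms(1)] st2_def k2_def q_def st1_def len1_def ..
  show "emit_pre j 1 len1 st"
    using assms(1-3) q ml by (intro emit_pre_within) (auto simp: len1_def)
  show le1: "pos st1 \<le> q" using q by (auto simp: st1_def len1_def)
  \<comment> \<open>If the first cut does not exhaust the job, the minimum in \<open>len1\<close> is
    the distance to the next border.\<close>
  have border: "load dvd pos st1" if "pos st1 < q"
  proof -
    have "pos st1 = pos st + (load - pos st mod load)"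
      using that q by (auto simp: st1_def len1_def min_def split: if_splits)
    also have "\<dots> = (pos st div load + 1) * load"
      using ml div_mult_mod_eq[of "pos st" load] unfolding distrib_right by linarith
    finally show ?thesis by simp
  qed
  have k2: "k2 = 0" if "\<not> pos st1 < q" using that by (simp add: k2_def)
  show "emit_pre j k2 load st1" if "0 < k2"
  proof -
    from that k2 have "pos st1 < q" by (cases "pos st1 < q") simp_all
    then have "load dvd pos st1" by (rule border)
    with that assms(1-3) l cur show ?thesis by (intro emit_pre_within) auto
  qed
  show pos2: "pos st2 = pos st1 + k2 * load" by (simp add: st2_def)
  have "k2 * load \<le> q - pos st1" unfolding k2_def by (rule div_times_less_eq_dividend)
  with le1 pos2 show "pos st2 \<le> q" by simp
  have "q - pos st1 < (k2 + 1) * load"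
    unfolding k2_def using dividend_less_times_div[OF l, of "q - pos st1"]
    by (simp add: algebra_simps)
  then have rest: "q - pos st2 \<le> load" using pos2 by simp
  show "emit_pre j 1 (q - pos st2) st2" if "pos st2 < q"
  proof -
    have "load dvd pos st2" using border that pos2 by simp
    with assms(1-3) that rest show ?thesis
      using cur by (intro emit_pre_within) auto
  qed
qed

lemma handle_Job:
  assumes "inv st" "j < n" "cls I j = cur st"
  shows "inv (handle (Job j) st)"
    and "pos (handle (Job j) st) = pos st + m * ptime I j"
    and "cur (handle (Job j) st) = cur st"
    and "job_measure (\<lambda>(a, b). b - a) j' (confs (handle (Job j) st))
       = job_measure (\<lambda>(a, b). b - a) j' (confs st) + (if j' = j then real (ptime I j) else 0)"
    and "v \<noteq> Splittable \<Longrightarrow> job_measure (\<lambda>_. 1) j' (confs (handle (Job j) st))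
       = job_measure (\<lambda>_. 1) j' (confs st) + (if j' = j then 1 else 0)"
proof -
  have l: "0 < load" using load_pos assms by blast
  have goal: "inv (handle (Job j) st) \<and> pos (handle (Job j) st) = pos st + m * ptime I j \<and>
      cur (handle (Job j) st) = cur st \<and>
      job_measure (\<lambda>(a, b). b - a) j' (confs (handle (Job j) st))
       = job_measure (\<lambda>(a, b). b - a) j' (confs st) + (if j' = j then real (ptime I j) else 0) \<and>
      (v \<noteq> Splittable \<longrightarrow> job_measure (\<lambda>_. 1) j' (confs (handle (Job j) st))
       = job_measure (\<lambda>_. 1) j' (confs st) + (if j' = j then 1 else 0))"
  proof (cases "v = Splittable")
    case False
    note pre = emit_pre_whole[OF False assms(2,3)]
    show ?thesis
      using False emit_inv(1)[OF assms(1) pre l] emit_amount[OF assms(1) pre l]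
        emit_count[OF assms(1) pre l] m_pos by simp
  next
    case True
    define q where "q = pos st + m * ptime I j"
    define len1 where "len1 = min (q - pos st) (load - pos st mod load)"
    define st1 where "st1 = emit j 1 len1 st"
    define k2 where "k2 = (q - pos st1) div load"
    define st2 where "st2 = (if 0 < k2 then emit j k2 load st1 else st1)"
    define st3 where "st3 = (if pos st2 < q then emit j 1 (q - pos st2) st2 else st2)"
    note defs = q_def len1_def st1_def k2_def st2_def
    note split = handle_Job_split[OF True assms(2,3), folded q_def, folded len1_def,
        folded st1_def, folded k2_def, folded st2_def, folded st3_def]
    have 1: "inv st1" unfolding st1_def by (rule emit_inv(1)[OF assms(1) split(2) l])
    have a1: "job_measure (\<lambda>(a, b). b - a) j' (confs st1)
        = job_measure (\<lambda>(a, b). b - a) j' (confs st) + (if j' = j then real len1 / real m else 0)"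
      using emit_amount[OF assms(1) split(2) l] by (simp add: st1_def)
    have 2: "inv st2" using 1 emit_inv(1)[OF 1 split(3) l] by (simp add: st2_def)
    have a2: "job_measure (\<lambda>(a, b). b - a) j' (confs st2)
        = job_measure (\<lambda>(a, b). b - a) j' (confs st1)
          + (if j' = j then real (k2 * load) / real m else 0)"
      using emit_amount[OF 1 split(3) l] by (simp add: st2_def)
    have 3: "inv st3" using 2 emit_inv(1)[OF 2 split(4) l] by (simp add: st3_def)
    have a3: "job_measure (\<lambda>(a, b). b - a) j' (confs st3)
        = job_measure (\<lambda>(a, b). b - a) j' (confs st2)
          + (if j' = j then real (q - pos st2) / real m else 0)"
      using emit_amount[OF 2 split(4) l] by (simp add: st3_def)
    have total: "len1 + k2 * load + (q - pos st2) = m * ptime I j"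
      using split(5-7) by (simp add: st1_def q_def)
    have "real len1 / m + real (k2 * load) / m + real (q - pos st2) / m
        = real (len1 + k2 * load + (q - pos st2)) / m"
      by (simp add: add_divide_distrib)
    also have "\<dots> = ptime I j" unfolding total using m_pos by simp
    finally have "job_measure (\<lambda>(a, b). b - a) j' (confs st3)
       = job_measure (\<lambda>(a, b). b - a) j' (confs st) + (if j' = j then real (ptime I j) else 0)"
      using a1 a2 a3 by simp
    moreover have "pos st3 = pos st + m * ptime I j"
      using split(5-7) by (auto simp: st3_def q_def)
    moreover have "cur st3 = cur st" by (simp add: st3_def st2_def st1_def)
    ultimately show ?thesis using split(1) 3 True by simp
  qed
  then show "inv (handle (Job j) st)"
    and "pos (handle (Job j) st) = pos st + m * ptime I j"
    and "cur (handle (Job j) st) = cur st"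
    and "job_measure (\<lambda>(a, b). b - a) j' (confs (handle (Job j) st))
       = job_measure (\<lambda>(a, b). b - a) j' (confs st) + (if j' = j then real (ptime I j) else 0)"
    and "v \<noteq> Splittable \<Longrightarrow> job_measure (\<lambda>_. 1) j' (confs (handle (Job j) st))
       = job_measure (\<lambda>_. 1) j' (confs st) + (if j' = j then 1 else 0)"
    by blast+
qed

lemma fold_handle:
  assumes "inv st" "admissible_events (cur st) es"
  shows "inv (fold handle es st)"
    and "pos (fold handle es st) = pos st + sum_list (map event_width es)"
    and "job_measure (\<lambda>(a, b). b - a) j (confs (fold handle es st))
       = job_measure (\<lambda>(a, b). b - a) j (confs st)
         + (\<Sum>e\<leftarrow>es. if e = Job j then real (ptime I j) else 0)"
    and "v \<noteq> Splittable \<Longrightarrow> job_measure (\<lambda>_. 1) j (confs (fold handle es st))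
       = job_measure (\<lambda>_. 1) j (confs st) + (\<Sum>e\<leftarrow>es. if e = Job j then 1 else 0)"
  using assms
proof (induction es arbitrary: st)
  case (Cons e es)
  {
    case 1
    with Cons.IH(1)[of "handle e st"] handle_Start_inv[of st] show ?case
      by (cases e) (auto simp: handle_Job simp del: handle.simps(2))
  next
    case 2
    with Cons.IH(2)[of "handle e st"] handle_Start_inv[of st] show ?case
      by (cases e) (auto simp: handle_Job simp del: handle.simps(2))
  next
    case 3
    with Cons.IH(3)[of "handle e st"] handle_Start_inv[of st] show ?case
      by (cases e) (auto simp: handle_Job simp del: handle.simps(2))
  next
    case 4
    with Cons.IH(4)[of "handle e st"] handle_Start_inv[of st] show ?case
      by (cases e) (auto simp: handle_Job simp del: handle.simps(2))
  }
qed simp_all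

section \<open>The order of the events\<close>

text \<open>The order is decreasing because the program inserts the jobs 0, 1, ... at the front of
  their lists.\<close>

definition bucket :: "nat \<Rightarrow> nat list" where
  "bucket i = rev (filter (\<lambda>j. cls I j = i) [0..<n])"

definition events :: "event list" where
  "events = concat (map (\<lambda>i. Start i # map Job (bucket i)) [0..<c])"

text \<open>Each job lies in the bucket of exactly one class, so exchanging the sums leaves it once.
  Choices of \<open>g\<close> yield the length of the line, the amount and the number of pieces of a
  job, and the number of events.\<close>

lemma sum_list_events:
  fixes g :: "event \<Rightarrow> 'a :: comm_monoid_add"
  shows "sum_list (map g events) = (\<Sum>i<c. g (Start i)) + (\<Sum>j<n. g (Job j))"
proof -
  have concat_sum: "sum_list (map g (concat (map f xs))) = (\<Sum>x\<leftarrow>xs. sum_list (map g (f x)))"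
    for f :: "nat \<Rightarrow> event list" and xs
    by (induction xs) auto
  have b: "sum_list (map g (map Job (bucket i))) = (\<Sum>j<n. if i = cls I j then g (Job j) else 0)" for i
  proof -
    have "sum_list (map g (map Job (bucket i)))
        = sum (g \<circ> Job) (set (filter (\<lambda>j. cls I j = i) [0..<n]))"
      unfolding bucket_def
      by (subst sum_list_distinct_conv_sum_set[symmetric])
        (simp_all add: comp_def rev_map[symmetric] sum_list_rev)
    also have "\<dots> = (\<Sum>j<n. if i = cls I j then g (Job j) else 0)"
      by (subst sum.inter_filter[symmetric]) (auto intro!: sum.cong)
    finally show ?thesis .
  qed
  have "sum_list (map g events)
      = (\<Sum>i\<leftarrow>[0..<c]. g (Start i) + (\<Sum>j<n. if i = cls I j then g (Job j) else 0))"
    unfolding events_def concat_sum list.map sum_list.Cons b ..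
  also have "\<dots> = (\<Sum>i<c. g (Start i)) + (\<Sum>i<c. \<Sum>j<n. if i = cls I j then g (Job j) else 0)"
    by (simp add: interv_sum_list_conv_sum_set_nat sum.distrib atLeast0LessThan)
  also have "(\<Sum>i<c. \<Sum>j<n. if i = cls I j then g (Job j) else 0) = (\<Sum>j<n. g (Job j))"
    by (subst sum.swap) (intro sum.cong, auto simp: class_less)
  finally show ?thesis .
qed

lemma admissible_events_blocks:
  "list_all (\<lambda>i. i < c) is \<Longrightarrow>
   admissible_events i (concat (map (\<lambda>i. Start i # map Job (bucket i)) is))"
proof (induction "is" arbitrary: i)
  case (Cons i' "is")
  have "admissible_events i' (map Job js @ es)"
    if "set js \<subseteq> {j. j < n \<and> cls I j = i'}" "admissible_events i' es" for js es
    using that by (induction js) auto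
  with Cons show ?case by (auto simp: bucket_def)
qed simp

section \<open>Feasibility and makespan of the resulting schedule\<close>

definition start_sched :: sched where
  "start_sched = \<lparr>pos = 0, used = 0, fresh = False, cur = 0, confs = []\<rparr>"

definition result :: compact_schedule where
  "result = (m, confs (fold handle events start_sched))"

lemma inv_start_sched: "inv start_sched"
  by (auto simp: inv_def inv_at_def start_sched_def)

lemma admissible_events_events: "admissible_events (cur start_sched) events"
  unfolding events_def by (rule admissible_events_blocks) (simp add: list_all_iff)

lemma event_width_events: "sum_list (map event_width events) = m * load"
  unfolding sum_list_events load_def by (simp add: sum_distrib_left algebra_simps)

text \<open>The last listed segment starts strictly before the filled position, which lies within
  the first \<open>m\<close> segments.\<close>

lemma inv_used_le:
  assumes "inv st" "pos st \<le> m * load"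
  shows "used st \<le> m"
proof (cases "used st = 0")
  case False
  from assms(1) obtain e where "inv_at e st" by (auto simp: inv_def)
  with False have "(used st - 1) * load < e" "e \<le> pos st"
    unfolding inv_at_def by simp_all
  with assms(2) have "(used st - 1) * load < m * load" by linarith
  then have "used st - 1 < m" by (simp only: mult_less_cancel2)
  then show ?thesis by simp
qed simp

lemma set_listed_machines:
  "set (listed_machines (m, cs)) \<subseteq> {scaled xs | k xs. (k, xs) \<in> set cs}"
  by (auto simp: listed_machines_def scaled_def)

lemma length_listed_machines: "length (listed_machines (m, cs)) = sum_list (map fst cs)"
  by (induction cs) (auto simp: listed_machines_def)

lemma job_intervals_append: "job_intervals (S @ S') j = job_intervals S j @ job_intervals S' j"
  by (simp add: job_intervals_def)

text \<open>This links the bookkeeping on configurations to feasibility: a multiplicity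
  \<open>k\<close> repeats its intervals \<open>k\<close> times, and idle machines add none.\<close>

lemma sum_job_intervals_expand:
  "(\<Sum>p\<leftarrow>job_intervals (expand I (m, cs)) j. h p) = job_measure h j cs"
proof -
  have empty: "job_intervals (replicate r []) j = []" for r
    by (induction r) (auto simp: job_intervals_def)
  have rep: "(\<Sum>p\<leftarrow>job_intervals (replicate k xs) j. h p)
      = real k * (\<Sum>x\<leftarrow>xs. \<Sum>p\<leftarrow>item_intervals j x. h p)" for k xs
  proof (induction k)
    case 0
    then show ?case by (simp add: job_intervals_def)
  next
    case (Suc k)
    have "(\<Sum>p\<leftarrow>job_intervals [xs] j. h p) = (\<Sum>x\<leftarrow>xs. \<Sum>p\<leftarrow>item_intervals j x. h p)"
      by (induction xs) (auto simp: job_intervals_def)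
    with Suc job_intervals_append[of "[xs]" "replicate k xs" j] show ?case
      by (simp add: algebra_simps)
  qed
  have "(\<Sum>p\<leftarrow>job_intervals (listed_machines (m, cs)) j. h p) = job_measure h j cs"
  proof (induction cs)
    case Nil
    then show ?case by (simp add: listed_machines_def job_measure_def job_intervals_def)
  next
    case (Cons x cs)
    obtain k xs where x: "x = (k, xs)" by (cases x)
    have "listed_machines (m, x # cs) = replicate k (scaled xs) @ listed_machines (m, cs)"
      by (simp add: listed_machines_def scaled_def x)
    with Cons rep show ?case by (simp add: job_intervals_append job_measure_def x)
  qed
  then show ?thesis by (simp add: expand_def job_intervals_append empty)
qed

lemma inv_result: "inv (fold handle events start_sched)"
  by (rule fold_handle(1)[OF inv_start_sched admissible_events_events])

lemma result_conf_ok: "(k, xs) \<in> set (snd result) \<Longrightarrow> conf_ok (base + load) xs"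
  using inv_result unfolding inv_def inv_at_def result_def snd_conv by blast

lemma admissible_result: "admissible_output v result"
proof -
  from inv_result obtain e where "inv_at e (fold handle events start_sched)" by (auto simp: inv_def)
  with m_pos show ?thesis
    unfolding inv_at_def admissible_output_def result_def by auto
qed

lemma set_expand_result:
  "set (expand I result) \<subseteq> insert [] {scaled xs | k xs. (k, xs) \<in> set (snd result)}"
  using set_listed_machines[of "snd result"] by (auto simp: expand_def result_def)

lemma feasible_result: "feasible v I (expand I result)"
proof -
  let ?st = "fold handle events start_sched"
  have "sum_list (map fst (confs ?st)) \<le> used ?st"
    using inv_result unfolding inv_def inv_at_def by blast
  also have "\<dots> \<le> m"
    using fold_handle(2)[OF inv_start_sched admissible_events_events]
    by (intro inv_used_le[OF inv_result]) (simp add: event_width_events start_sched_def)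
  finally have len: "length (expand I result) = m"
    by (simp add: expand_def length_listed_machines result_def)
  have ok: "\<forall>xs\<in>set (expand I result). machine_ok I xs"
    using set_expand_result result_conf_ok by (fastforce simp: conf_ok_def machine_ok_Nil)
  have "(\<Sum>(a, b)\<leftarrow>job_intervals (expand I result) j. b - a) = real (ptime I j) \<and>
      variant_ok v (job_intervals (expand I result) j)" if j: "j < n" for j
  proof
    show "(\<Sum>(a, b)\<leftarrow>job_intervals (expand I result) j. b - a) = real (ptime I j)"
      using j unfolding result_def sum_job_intervals_expand
        fold_handle(3)[OF inv_start_sched admissible_events_events] sum_list_events
      by (simp add: start_sched_def job_measure_def)
    show "variant_ok v (job_intervals (expand I result) j)"
    proof (cases "v = Splittable")
      case False
      \<comment> \<open>With weight 1 the measure counts intervals. A single interval satisfies the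
        non-preemptive and the preemptive condition alike.\<close>
      have "real (length (job_intervals (expand I result) j))
          = (\<Sum>p\<leftarrow>job_intervals (expand I result) j. 1)" by (simp add: sum_list_triv)
      also have "\<dots> = 1"
        using j unfolding result_def sum_job_intervals_expand
          fold_handle(4)[OF inv_start_sched admissible_events_events False] sum_list_events
        by (simp add: start_sched_def job_measure_def)
      finally have "length (job_intervals (expand I result) j) = 1" by simp
      with False show ?thesis by (cases v) (auto simp: length_Suc_conv)
    qed simp
  qed
  with len ok show ?thesis by (simp add: feasible_def)
qed

lemma makespan_result_le:
  assumes "feasible v I S"
  shows "makespan I (expand I result) \<le> 2 * makespan I S"
proof -
  have "real load \<le> real m * makespan I S"
    unfolding load_def by (rule load_le_makespan[OF assms valid])
  moreover have "real (Max (insert 0 (width ` {..<n}))) \<le> makespan I S"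
  proof -
    have "Max (insert 0 (width ` {..<n})) \<in> insert 0 (width ` {..<n})"
      by (rule Max_in) auto
    moreover have "real (width j) \<le> makespan I S" if "j < n" for j
      using stime_le_makespan[OF assms valid class_less[OF that]]
        stime_ptime_le_makespan[OF assms _ valid that] by (simp add: width_def)
    ultimately show ?thesis by (auto simp: makespan_nonneg)
  qed
  moreover have "real (base + load) / real m
      = real (Max (insert 0 (width ` {..<n}))) + real load / real m"
    using m_pos by (simp add: base_def add_divide_distrib)
  ultimately have bound: "real (base + load) / real m \<le> 2 * makespan I S"
    using m_pos pos_divide_le_eq[of "real m" "real load" "makespan I S"] by (simp add: mult.commute)
  have "item_end I x \<le> real (base + load) / real m" if "x \<in> set (concat (expand I result))" for x
    using that set_expand_result result_conf_ok by (fastforce simp: conf_ok_def)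
  with bound have "item_end I x \<le> 2 * makespan I S" if "x \<in> set (concat (expand I result))" for x
    using that by fastforce
  then show ?thesis
    unfolding makespan_def[of I "expand I result"] by (intro Max.boundedI) (auto simp: makespan_nonneg)
qed

text \<open>Attainment of the infimum is avoided: half the makespan is below that of every feasible
  schedule, and the constructed schedule shows that there is one.\<close>

lemma makespan_result_le_OPT: "makespan I (expand I result) \<le> 2 * OPT v I"
proof -
  have "makespan I (expand I result) / 2 \<le> OPT v I"
    unfolding OPT_def
    by (rule cINF_greatest) (use feasible_result makespan_result_le in force)+
  then show ?thesis by simp
qed

end


section \<open>The program\<close>

abbreviation (input) "eadd e1 e2 \<equiv> Bin Add e1 e2"
abbreviation (input) "esub e1 e2 \<equiv> Bin Sub e1 e2"
abbreviation (input) "emul e1 e2 \<equiv> Bin Mul e1 e2"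
abbreviation (input) "ediv e1 e2 \<equiv> Bin Div e1 e2"
abbreviation (input) "eless e1 e2 \<equiv> Bin Less e1 e2"

abbreviation (input) "r_m \<equiv> 2 :: nat"
abbreviation (input) "r_n \<equiv> 3 :: nat"
abbreviation (input) "r_c \<equiv> 4 :: nat"
abbreviation (input) "r_load \<equiv> 5 :: nat"
abbreviation (input) "r_base \<equiv> 6 :: nat"
abbreviation (input) "r_i \<equiv> 7 :: nat"
abbreviation (input) "r_j \<equiv> 8 :: nat"
abbreviation (input) "r_pos \<equiv> 9 :: nat"
abbreviation (input) "r_used \<equiv> 10 :: nat"
abbreviation (input) "r_fresh \<equiv> 11 :: nat"
abbreviation (input) "r_k \<equiv> 12 :: nat"
abbreviation (input) "r_len \<equiv> 13 :: nat"
abbreviation (input) "r_u \<equiv> 14 :: nat"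
abbreviation (input) "r_a \<equiv> 15 :: nat"
abbreviation (input) "r_q \<equiv> 16 :: nat"

text \<open>Behind the input the memory holds one singly linked list of jobs per class: the list heads
  and, for every job, the link to the next job of its class. A link to job \<open>j\<close> is stored as \<open>j + 1\<close>,
  0 ends the list.\<close>

abbreviation (input) "stime_addr e \<equiv> eadd (Const 3) e"
abbreviation (input) "ptime_addr e \<equiv> eadd (eadd (Const 3) (Reg r_c)) e"
abbreviation (input) "cls_addr e \<equiv> eadd (eadd (eadd (Const 3) (Reg r_c)) (Reg r_n)) e"
abbreviation (input) "head_addr e \<equiv>
  eadd (eadd (eadd (eadd (Const 3) (Reg r_c)) (Reg r_n)) (Reg r_n)) e"
abbreviation (input) "next_addr e \<equiv>
  eadd (eadd (eadd (eadd (eadd (Const 3) (Reg r_c)) (Reg r_n)) (Reg r_n)) (Reg r_c)) e"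

fun seq :: "prog list \<Rightarrow> prog" where
  "seq [] = Skip"
| "seq (p # ps) = Seq p (seq ps)"

definition place_prog :: prog where
  "place_prog = seq
    [Assign r_u (ediv (esub (eadd (Reg r_pos) (Reg r_len)) (Const 1)) (Reg r_load)),
     Assign r_a (esub (eadd (Reg r_base) (Reg r_pos)) (emul (Reg r_u) (Reg r_load)))]"

text \<open>Opening a machine raises the flag of a fresh class as well, so that
  \<open>setup_prog\<close> tests one flag for both reasons to insert a setup.\<close>

definition header_prog :: prog where
  "header_prog = If (Bin Equal (eadd (Reg r_u) (Const 1)) (Reg r_used)) Skip
     (seq [Output (Const 0), Output (Reg r_k), Assign r_fresh (Const 1)])"

text \<open>While jobs are placed, \<open>r_i\<close> already names the next class, hence the index
  \<open>r_i - 1\<close>.\<close>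

definition setup_prog :: prog where
  "setup_prog = If (Reg r_fresh)
     (seq [Output (Const 1), Output (esub (Reg r_i) (Const 1)),
           Output (esub (Reg r_a)
             (emul (Reg r_m) (Mem (stime_addr (esub (Reg r_i) (Const 1)))))),
           Assign r_fresh (Const 0)])
     Skip"

definition piece_prog :: prog where
  "piece_prog = seq
    [Output (Const 2), Output (esub (Reg r_j) (Const 1)),
     Output (Reg r_a), Output (eadd (Reg r_a) (Reg r_len)),
     Assign r_pos (eadd (Reg r_pos) (emul (Reg r_k) (Reg r_len)))]"

definition emit_prog :: prog where
  "emit_prog = seq [place_prog, header_prog, Assign r_used (eadd (Reg r_u) (Reg r_k)),
     setup_prog, piece_prog]"

abbreviation (input) "job_length \<equiv>
  emul (Reg r_m) (Mem (ptime_addr (esub (Reg r_j) (Const 1))))"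

definition whole_job_prog :: prog where
  "whole_job_prog = seq [Assign r_k (Const 1), Assign r_len job_length, emit_prog]"

text \<open>There is no remainder operation, so the distance to the border is computed from the
  quotient; \<open>r_a\<close> is scratch until the next emission.\<close>

definition first_cut_prog :: prog where
  "first_cut_prog = seq
    [Assign r_q (eadd (Reg r_pos) job_length),
     Assign r_k (Const 1),
     Assign r_len (esub (Reg r_q) (Reg r_pos)),
     Assign r_a (esub (Reg r_load)
       (esub (Reg r_pos) (emul (ediv (Reg r_pos) (Reg r_load)) (Reg r_load)))),
     If (eless (Reg r_a) (Reg r_len)) (Assign r_len (Reg r_a)) Skip]"

definition middle_prog :: prog where
  "middle_prog = seq
    [Assign r_k (ediv (esub (Reg r_q) (Reg r_pos)) (Reg r_load)),
     If (Reg r_k) (seq [Assign r_len (Reg r_load), emit_prog]) Skip]"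

definition rest_prog :: prog where
  "rest_prog = If (eless (Reg r_pos) (Reg r_q))
     (seq [Assign r_k (Const 1), Assign r_len (esub (Reg r_q) (Reg r_pos)), emit_prog]) Skip"

definition split_job_prog :: prog where
  "split_job_prog = seq [first_cut_prog, emit_prog, middle_prog, rest_prog]"

definition job_prog :: "variant \<Rightarrow> prog" where
  "job_prog v = (if v = Splittable then split_job_prog else whole_job_prog)"

text \<open>One flat loop replaces a nested one: a nonzero link means a job, a zero link the start
  of the next class. The number of iterations is then the number of events.\<close>

definition step_prog :: "variant \<Rightarrow> prog" where
  "step_prog v = If (Reg r_j)
     (seq [job_prog v, Assign r_j (Mem (next_addr (esub (Reg r_j) (Const 1))))])
     (seq [Assign r_pos (eadd (Reg r_pos) (emul (Reg r_m) (Mem (stime_addr (Reg r_i))))),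
           Assign r_fresh (Const 1),
           Assign r_j (Mem (head_addr (Reg r_i))),
           Assign r_i (eadd (Reg r_i) (Const 1))])"

text \<open>The sum acts as a disjunction: jobs are left in the current list, or classes are
  left.\<close>

definition main_cond :: expr where
  "main_cond = eadd (Reg r_j) (eless (Reg r_i) (Reg r_c))"

definition class_prog :: prog where
  "class_prog = seq
    [Assign r_load (eadd (Reg r_load) (Mem (stime_addr (Reg r_i)))),
     Assign r_i (eadd (Reg r_i) (Const 1))]"

definition read_prog :: "variant \<Rightarrow> prog" where
  "read_prog v = seq
    [Assign r_q (Mem (cls_addr (Reg r_j))),
     Assign r_load (eadd (Reg r_load) (Mem (ptime_addr (Reg r_j)))),
     Assign r_a (if v = Splittable then Mem (stime_addr (Reg r_q))
       else eadd (Mem (stime_addr (Reg r_q))) (Mem (ptime_addr (Reg r_j)))),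
     If (eless (Reg r_base) (Reg r_a)) (Assign r_base (Reg r_a)) Skip]"

text \<open>The list heads need no initialisation, since memory behind the input is 0, the empty
  list. Insertion at the front takes constant time.\<close>

definition link_prog :: prog where
  "link_prog = seq
    [Store (next_addr (Reg r_j)) (Mem (head_addr (Reg r_q))),
     Store (head_addr (Reg r_q)) (eadd (Reg r_j) (Const 1)),
     Assign r_j (eadd (Reg r_j) (Const 1))]"

definition read_job_prog :: "variant \<Rightarrow> prog" where
  "read_job_prog v = seq [read_prog v, link_prog]"

definition schedule_prog :: "variant \<Rightarrow> prog" where
  "schedule_prog v = seq
    [Assign r_m (Mem (Const 0)), Assign r_n (Mem (Const 1)), Assign r_c (Mem (Const 2)),
     While (eless (Reg r_i) (Reg r_c)) class_prog,
     While (eless (Reg r_j) (Reg r_n)) (read_job_prog v),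
     Assign r_base (emul (Reg r_m) (Reg r_base)),
     Assign r_i (Const 0),
     Assign r_j (Const 0),
     Output (Reg r_m),
     While main_cond (step_prog v)]"


section \<open>Correctness and running time of the program\<close>

text \<open>A halting run is asserted to exist, so both divergence and a word overflow, which leaves
  the program stuck, refute it.\<close>

definition wp :: "nat \<Rightarrow> prog \<Rightarrow> (nat \<Rightarrow> ram_state \<Rightarrow> bool) \<Rightarrow> ram_state \<Rightarrow> bool" where
  "wp W p Q s \<longleftrightarrow> (\<exists>t s'. exec W p s t s' \<and> Q t s')"

lemma wp_Skip: "Q 1 s \<Longrightarrow> wp W Skip Q s"
  unfolding wp_def using exec.Skip by blast

text \<open>The new state is described by equations for its components: a chain of updates in which each
  value refers to the state before it grows exponentially.\<close>

lemma wp_Assign: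
  assumes "fits W s e"
    and "\<And>s'. \<lbrakk>regs s' = (regs s)(r := eval s e); mem s' = mem s; out s' = out s\<rbrakk>
      \<Longrightarrow> Q (1 + cost e) s'"
  shows "wp W (Assign r e) Q s"
  unfolding wp_def by (intro exI conjI, rule exec.Assign, rule assms(1), rule assms(2)) simp_all

lemma wp_Store:
  assumes "fits W s e1" "fits W s e2"
    and "\<And>s'. \<lbrakk>regs s' = regs s; mem s' = (mem s)(eval s e1 := eval s e2); out s' = out s\<rbrakk>
      \<Longrightarrow> Q (1 + cost e1 + cost e2) s'"
  shows "wp W (Store e1 e2) Q s"
  unfolding wp_def
  by (intro exI conjI, rule exec.Store, rule assms(1), rule assms(2), rule assms(3)) simp_all

lemma wp_Output:
  assumes "fits W s e"
    and "\<And>s'. \<lbrakk>regs s' = regs s; mem s' = mem s; out s' = out s @ [eval s e]\<rbrakk>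
      \<Longrightarrow> Q (1 + cost e) s'"
  shows "wp W (Output e) Q s"
  unfolding wp_def by (intro exI conjI, rule exec.Output, rule assms(1), rule assms(2)) simp_all

lemma wp_Seq:
  "wp W p (\<lambda>t s'. wp W q (\<lambda>t' s''. Q (t + t') s'') s') s \<Longrightarrow> wp W (Seq p q) Q s"
  by (auto simp: wp_def intro: exec.Seq)

lemma wp_If:
  assumes "fits W s e"
    and "eval s e \<noteq> 0 \<Longrightarrow> wp W p (\<lambda>t s'. Q (1 + cost e + t) s') s"
    and "eval s e = 0 \<Longrightarrow> wp W q (\<lambda>t s'. Q (1 + cost e + t) s') s"
  shows "wp W (If e p q) Q s"
  using assms unfolding wp_def by (cases "eval s e = 0") (metis exec.IfTrue exec.IfFalse)+

lemma wp_mono: "wp W p Q s \<Longrightarrow> (\<And>t s'. Q t s' \<Longrightarrow> Q' t s') \<Longrightarrow> wp W p Q' s"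
  by (auto simp: wp_def)

text \<open>\<open>P\<close> relates the list still to be processed and an abstract state to the RAM
  state. The list is at once termination measure and iteration count; no loop of the program is
  nested, so a uniform bound \<open>b\<close> per iteration is enough.\<close>

lemma wp_While_list:
  assumes step: "\<And>x xs a s. P (x # xs) a s \<Longrightarrow> fits W s e \<and> eval s e \<noteq> 0 \<and>
      wp W p (\<lambda>t s'. t \<le> b \<and> P xs (f x a) s') s"
    and final: "\<And>a s. P [] a s \<Longrightarrow> fits W s e \<and> eval s e = 0"
    and init: "P xs a s"
  shows "wp W (While e p)
    (\<lambda>t s'. t \<le> length xs * (b + 1 + cost e) + 1 + cost e \<and> P [] (fold f xs a) s') s"
  using init
proof (induction xs arbitrary: a s)
  case Nil
  with final[of a s] show ?case
    unfolding wp_def by (intro exI conjI, rule_tac exec.WhileFalse) auto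
next
  case (Cons x xs)
  from step[OF Cons.prems] obtain t s1 where 1: "fits W s e" "eval s e \<noteq> 0"
    "exec W p s t s1" "t \<le> b" "P xs (f x a) s1" by (auto simp: wp_def)
  from Cons.IH[OF 1(5)] obtain t' s2 where 2: "exec W (While e p) s1 t' s2"
    "t' \<le> length xs * (b + 1 + cost e) + 1 + cost e" "P [] (fold f xs (f x a)) s2"
    by (auto simp: wp_def)
  from exec.WhileTrue[OF 1(1-3) 2(1)] 1(4) 2(2,3) show ?case
    unfolding wp_def by (intro exI[of _ "1 + cost e + t + t'"] exI[of _ s2]) (simp add: algebra_simps)
qed

lemma wp_While_upt:
  assumes step: "\<And>i s. i < N \<Longrightarrow> P i s \<Longrightarrow> fits W s e \<and> eval s e \<noteq> 0 \<and>
      wp W p (\<lambda>t s'. t \<le> b \<and> P (Suc i) s') s"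
    and final: "\<And>s. P N s \<Longrightarrow> fits W s e \<and> eval s e = 0"
    and init: "P 0 s"
  shows "wp W (While e p) (\<lambda>t s'. t \<le> N * (b + 1 + cost e) + 1 + cost e \<and> P N s') s"
proof -
  let ?P = "\<lambda>xs (a :: unit) s. \<exists>i\<le>N. [i..<N] = xs \<and> P i s"
  have "wp W (While e p) (\<lambda>t s'. t \<le> length [0..<N] * (b + 1 + cost e) + 1 + cost e
      \<and> ?P [] (fold (\<lambda>_ a. a) [0..<N] ()) s') s"
  proof (rule wp_While_list)
    fix x xs a s
    assume "?P (x # xs) a s"
    then have "x < N" "xs = [Suc x..<N]" "P x s" by (auto simp: upt_eq_Cons_conv)
    with step[of x s] show "fits W s e \<and> eval s e \<noteq> 0 \<and> wp W p (\<lambda>t s'. t \<le> b \<and> ?P xs a s') s"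
      by (auto elim!: wp_mono intro!: exI[of _ "Suc x"])
  qed (use final init in auto)
  then show ?thesis by (rule wp_mono) auto
qed

lemmas wp_intros = wp_Skip wp_Assign wp_Store wp_Output wp_Seq wp_If

section \<open>Linked lists, output, and the pieces of the program\<close>

fun chain :: "nat \<Rightarrow> (nat \<Rightarrow> nat) \<Rightarrow> nat list \<Rightarrow> nat \<Rightarrow> bool" where
  "chain b M [] p \<longleftrightarrow> p = 0"
| "chain b M (j # js) p \<longleftrightarrow> p = Suc j \<and> chain b M js (M (b + j))"

lemma chain_cong:
  "(\<And>j. j \<in> set js \<Longrightarrow> M (b + j) = M' (b + j)) \<Longrightarrow> chain b M js p = chain b M' js p"
  by (induction js arbitrary: p) auto

text \<open>Configurations have a header but no end marker, so adding items to the last one just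
  appends to the tape.\<close>

lemma encode_extend_last:
  "cs \<noteq> [] \<Longrightarrow> concat (map encode_config (extend_last cs xs))
    = concat (map encode_config cs) @ concat (map encode_item xs)"
  by (cases cs rule: rev_cases) (auto simp: extend_last_def split: prod.splits)

lemma wp_place_prog:
  assumes "regs s r_pos + regs s r_len \<le> W" "regs s r_base + regs s r_pos \<le> W" "1 \<le> W"
    "regs s r_load \<le> W"
  shows "wp W place_prog (\<lambda>t s'. t \<le> 20 \<and> mem s' = mem s \<and> out s' = out s \<and>
    (let u = (regs s r_pos + regs s r_len - 1) div regs s r_load in
      regs s' = (regs s)(r_u := u, r_a := regs s r_base + regs s r_pos - u * regs s r_load))) s"
proof -
  have u: "(regs s r_pos + regs s r_len - 1) div regs s r_load \<le> W"
    using assms(1) div_le_dividend[of "regs s r_pos + regs s r_len - 1" "regs s r_load"] by linarith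
  have u': "(regs s r_pos + regs s r_len - 1) div regs s r_load * regs s r_load \<le> W"
    using assms(1) div_times_less_eq_dividend[of "regs s r_pos + regs s r_len - 1" "regs s r_load"]
    by linarith
  show ?thesis
    unfolding place_prog_def seq.simps
    by (intro wp_intros) (use assms u u' in \<open>simp_all add: Let_def\<close>)
qed

lemma wp_header_prog:
  assumes "regs s r_u + 1 \<le> W" "regs s r_used \<le> W" "regs s r_k \<le> W"
  shows "wp W header_prog (\<lambda>t s'. t \<le> 20 \<and> mem s' = mem s \<and>
    (if regs s r_u + 1 = regs s r_used then regs s' = regs s \<and> out s' = out s
     else regs s' = (regs s)(r_fresh := 1) \<and> out s' = out s @ [0, regs s r_k])) s"
  unfolding header_prog_def seq.simps
  by (intro wp_intros) (use assms in \<open>simp_all split: if_splits\<close>)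

lemma wp_setup_prog:
  assumes "regs s r_i = Suc i" "i + 4 \<le> W" "regs s r_a \<le> W" "regs s r_m * mem s (3 + i) \<le> W"
    "mem s (3 + i) \<le> W" "regs s r_m \<le> W" "regs s r_fresh = of_bool f"
  shows "wp W setup_prog (\<lambda>t s'. t \<le> 30 \<and> mem s' = mem s \<and>
    regs s' = (regs s)(r_fresh := 0) \<and>
    out s' = out s @ (if f then [1, i, regs s r_a - regs s r_m * mem s (3 + i)] else [])) s"
  unfolding setup_prog_def seq.simps
  by (intro wp_intros) (use assms in \<open>simp_all add: fun_upd_idem split: if_splits\<close>)

lemma wp_piece_prog:
  assumes "regs s r_j = Suc j" "Suc j \<le> W" "2 \<le> W" "regs s r_a + regs s r_len \<le> W"
    "regs s r_pos + regs s r_k * regs s r_len \<le> W" "regs s r_k \<le> W"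
  shows "wp W piece_prog (\<lambda>t s'. t \<le> 30 \<and> mem s' = mem s \<and>
    regs s' = (regs s)(r_pos := regs s r_pos + regs s r_k * regs s r_len) \<and>
    out s' = out s @ [2, j, regs s r_a, regs s r_a + regs s r_len]) s"
  unfolding piece_prog_def seq.simps
  by (intro wp_intros) (use assms in simp_all)

lemma wp_first_cut_prog:
  assumes "fits W s job_length" "eval s job_length = L" "regs s r_pos + L \<le> W" "regs s r_load \<le> W"
    "1 \<le> W"
  shows "wp W first_cut_prog (\<lambda>t s'. t \<le> 100 \<and> mem s' = mem s \<and> out s' = out s \<and>
    (\<exists>a. regs s' = (regs s)(r_q := regs s r_pos + L, r_k := 1,
       r_len := min L (regs s r_load - regs s r_pos mod regs s r_load), r_a := a))) s"
proof -
  have mod: "regs s r_pos - regs s r_pos div regs s r_load * regs s r_load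
      = regs s r_pos mod regs s r_load"
    by (simp add: minus_div_mult_eq_mod)
  have div: "regs s r_pos div regs s r_load \<le> W"
    "regs s r_pos div regs s r_load * regs s r_load \<le> W"
    using assms(3) div_le_dividend[of "regs s r_pos" "regs s r_load"]
      div_times_less_eq_dividend[of "regs s r_pos" "regs s r_load"] by linarith+
  show ?thesis
    unfolding first_cut_prog_def seq.simps
    by (intro wp_intros)
      (use assms mod div in \<open>auto simp: fun_eq_iff min_def split: if_splits\<close>)
qed

context batch
begin

section \<open>Simulation of the functional scheduler\<close>

text \<open>Positions, \<open>base\<close> and \<open>load\<close> are at most
  \<open>m * load\<close>, and addresses range over five arrays of size \<open>n\<close> or
  \<open>c\<close>; the constants generously cover sums of a few of these.\<close>

definition word_ok :: "nat \<Rightarrow> bool" where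
  "word_ok W \<longleftrightarrow> 4 * (m * load) + 10 * (n + c) + 20 \<le> W \<and> m \<le> W"

text \<open>Scratch registers and the two pointers \<open>r_i\<close>, \<open>r_j\<close> are left
  out, so changing them preserves the relation. One \<open>M\<close> serves throughout because the
  main loop stores nothing.\<close>

definition core :: "nat \<Rightarrow> (nat \<Rightarrow> nat) \<Rightarrow> sched \<Rightarrow> ram_state \<Rightarrow> bool" where
  "core W M st s \<longleftrightarrow> regs s r_m = m \<and> regs s r_n = n \<and> regs s r_c = c \<and>
     regs s r_load = load \<and> regs s r_base = base \<and> regs s r_pos = pos st \<and>
     regs s r_used = used st \<and> regs s r_fresh = of_bool (fresh st) \<and>
     out s = m # concat (map encode_config (confs st)) \<and> mem s = M \<and>
     (\<forall>i<c. M (3 + i) = stime I i) \<and> (\<forall>j<n. M (3 + c + j) = ptime I j) \<and>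
     (\<forall>i<c. chain (3 + c + n + n + c) M (bucket i) (M (3 + c + n + n + i))) \<and> (\<forall>a. M a \<le> W)"

text \<open>The setup time and the processing time are distinct summands of
  \<open>load\<close>.\<close>

lemma width_le_load: "j < n \<Longrightarrow> width j \<le> load"
  using member_le_sum[of "cls I j" "{..<c}" "stime I"] member_le_sum[of j "{..<n}" "ptime I"]
    class_less[of j] by (simp add: width_def load_def)

lemma base_le: "base \<le> m * load"
proof -
  have "Max (insert 0 (width ` {..<n})) \<le> load"
    by (intro Max.boundedI) (auto simp: width_le_load)
  then show ?thesis by (simp add: base_def)
qed

lemma load_le_m_load: "load \<le> m * load"
  using m_pos by simp

lemma stime_le_load: "i < c \<Longrightarrow> stime I i \<le> load"
  using member_le_sum[of i "{..<c}" "stime I"] by (simp add: load_def)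

lemma ptime_le_load: "j < n \<Longrightarrow> ptime I j \<le> load"
  using member_le_sum[of j "{..<n}" "ptime I"] by (simp add: load_def)

lemma wp_emit:
  assumes core: "core W M st s" and W: "word_ok W" and inv: "inv st" and pre: "emit_pre j k len st"
    and le: "pos st + k * len \<le> m * load"
    and regs: "regs s r_i = Suc (cur st)" "regs s r_j = Suc j" "regs s r_k = k" "regs s r_len = len"
  shows "wp W emit_prog (\<lambda>t s'. t \<le> 150 \<and> core W M (emit j k len st) s' \<and>
     regs s' r_i = regs s r_i \<and> regs s' r_j = regs s r_j \<and> regs s' r_q = regs s r_q) s"
proof -
  define u where "u = (pos st + len - 1) div load"
  define a where "a = base + pos st - u * load"
  have j: "j < n" "cls I j = cur st" and kl: "0 < k" "0 < len" using pre by (auto simp: emit_pre_def)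
  have i: "cur st < c" using class_less[OF j(1)] j by simp
  have room: "m * stime I (cur st) + u * load \<le> base + pos st"
    using pre by (simp add: emit_pre_def u_def)
  have W4: "4 * (m * load) \<le> W" "n + c + 20 \<le> W" "m \<le> W" using W by (auto simp: word_ok_def)
  have "u \<le> pos st + len - 1" unfolding u_def by (rule div_le_dividend)
  moreover have uload: "u * load \<le> pos st + len - 1"
    unfolding u_def by (rule div_times_less_eq_dividend)
  moreover have "len \<le> k * len" "k \<le> k * len" using kl by simp_all
  moreover have "used st \<le> m" using inv le by (intro inv_used_le) auto
  moreover have "m * stime I (cur st) \<le> m * load" using stime_le_load[OF i] by simp
  moreover have "a \<le> base + pos st" by (simp add: a_def)
  ultimately have bounds: "pos st + len \<le> W" "base + pos st \<le> W" "u \<le> W" "u * load \<le> W"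
      "a \<le> W" "a + len \<le> W" "u + k \<le> W" "u + 1 \<le> W" "pos st + k * len \<le> W" "k * len \<le> W"
      "m * stime I (cur st) \<le> W" "used st \<le> W" "k \<le> W" "len \<le> W" "load \<le> W"
      "base \<le> W" "pos st \<le> W" 
    using le W4 base_le load_le_m_load kl by linarith+
  have bounds2: "m \<le> W" "Suc j \<le> W" "j \<le> W" "Suc (cur st) \<le> W" "cur st \<le> W" "cur st + 4 \<le> W" "3 + cur st \<le> W" "3 \<le> W"
    using W4 i j by linarith+
  have "M (3 + cur st) \<le> W" using core unfolding core_def by blast
  moreover have "M (3 + cur st) = stime I (cur st)" "mem s = M" using core i by (auto simp: core_def)
  ultimately have M: "stime I (cur st) \<le> W" "M (3 + cur st) = stime I (cur st)" "mem s = M" by auto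
  note regs' = core[unfolded core_def] regs
  define new where "new \<longleftrightarrow> u + 1 \<noteq> used st"
  define xs where "xs = (if fresh st \<or> new then [Setup (cur st) (a - m * stime I (cur st))] else [])
    @ [Piece j a (a + len)]"
  have emit: "emit j k len st = st\<lparr>pos := pos st + k * len, used := u + k, fresh := False,
      confs := (if new then confs st @ [(k, xs)] else extend_last (confs st) xs)\<rparr>"
    by (simp add: emit_def Let_def u_def a_def new_def xs_def)
  have ne: "confs st \<noteq> []" if "\<not> new" using that inv by (auto simp: new_def inv_def inv_at_def)
  show ?thesis
    unfolding emit_prog_def seq.simps
  proof (intro wp_Seq wp_mono[OF wp_place_prog], goal_cases)
    case (5 t1 s1)
    then have s1: "t1 \<le> 20" "mem s1 = M" "out s1 = out s" "regs s1 = (regs s)(r_u := u, r_a := a)"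
      using regs' M by (auto simp: u_def a_def Let_def)
    show ?case
    proof (intro wp_Seq wp_mono[OF wp_header_prog], goal_cases)
      case (4 t2 s2)
      then have s2: "t2 \<le> 20" "mem s2 = M"
        "regs s2 = (regs s)(r_u := u, r_a := a, r_fresh := of_bool (fresh st \<or> new))"
        "out s2 = out s @ (if new then [0, k] else [])"
        using s1 regs' by (auto simp: new_def fun_eq_iff split: if_splits)
      show ?case
      proof (intro wp_Seq wp_Assign wp_mono[OF wp_setup_prog[where i = "cur st" and f = "fresh st \<or> new"]], goal_cases)
        case (9 s3 t4 s4)
        note s3 = 9(1-3) and s4 = 9(4)
        show ?case
        proof (intro wp_Seq wp_Skip wp_mono[OF wp_piece_prog[where j = j]], goal_cases)
          case (7 t5 s5)
          then have s5: "t5 \<le> 30" "mem s5 = M"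
            "regs s5 = (regs s)(r_u := u, r_a := a, r_fresh := 0, r_used := u + k,
               r_pos := pos st + k * len)"
            "out s5 = out s @ (if new then [0, k] else []) @
               (if fresh st \<or> new then [1, cur st, a - m * stime I (cur st)] else []) @
               [2, j, a, a + len]"
            using s1 s2 s3 s4 regs' M by (auto simp: fun_eq_iff)
          \<comment> \<open>A new machine contributes the header \<open>[0, k]\<close> and its
            items, a continued one only its items, exactly as the tape grows.\<close>
          have cs: "m # concat (map encode_config (confs (emit j k len st))) = out s5"
            using s5(4) regs' ne by (auto simp: emit encode_extend_last xs_def)
          have "core W M (emit j k len st) s5"
            using core s5(2,3) cs unfolding core_def by (simp add: emit)
          with s5(3) show ?case using 7(1) s1(1) s2(1) s3 s4 by simp
        qed (use s1 s2 s3 s4 regs' bounds bounds2 in simp_all)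
      qed (use s1 s2 regs' bounds bounds2 M in simp_all)
    qed (use s1 regs' bounds bounds2 in simp_all)
  qed (use regs' bounds bounds2 in simp_all)
qed

lemma core_cong:
  assumes "core W M st s" "regs s' = (regs s)(r_k := k, r_len := l, r_u := u, r_a := a, r_q := q)"
    "mem s' = mem s" "out s' = out s"
  shows "core W M st s'"
  using assms by (simp add: core_def)

lemma core_simps:
  assumes "core W M st s"
  shows "regs s r_m = m" "regs s r_n = n" "regs s r_c = c" "regs s r_load = load"
    "regs s r_base = base" "regs s r_pos = pos st" "regs s r_used = used st"
    "regs s r_fresh = of_bool (fresh st)" "mem s = M"
    "i < c \<Longrightarrow> M (3 + i) = stime I i" "j < n \<Longrightarrow> M (3 + c + j) = ptime I j" "M a \<le> W"
  using assms by (simp_all add: core_def)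

lemma job_length_ok:
  assumes "core W M st s" "word_ok W" "regs s r_j = Suc j" "j < n"
  shows "fits W s job_length" "eval s job_length = m * ptime I j"
proof -
  have "m * ptime I j \<le> m * load" using ptime_le_load[OF assms(4)] by simp
  moreover have "4 * (m * load) \<le> W" "n + c + 20 \<le> W" "m \<le> W" "ptime I j \<le> m * load"
    using assms(2) order_trans[OF ptime_le_load[OF assms(4)] load_le_m_load]
    by (auto simp: word_ok_def)
  ultimately have "m * ptime I j \<le> W" "ptime I j \<le> W" "3 + c + j \<le> W" "Suc j \<le> W" "m \<le> W"
    using assms(4) by linarith+
  then show "fits W s job_length" "eval s job_length = m * ptime I j"
    using core_simps[OF assms(1)] assms(3,4) by simp_all
qed

text \<open>In the splittable case the four phases take at most 100, 150, 170 and 170 steps, which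
  explains 600; otherwise there is a single emission.\<close>

lemma wp_job:
  assumes core: "core W M st s" and W: "word_ok W" and inv: "inv st"
    and j: "j < n" "cls I j = cur st" and le: "pos st + m * ptime I j \<le> m * load"
    and regs: "regs s r_i = Suc (cur st)" "regs s r_j = Suc j"
  shows "wp W (job_prog v) (\<lambda>t s'. t \<le> 600 \<and> core W M (handle (Job j) st) s' \<and>
     regs s' r_i = Suc (cur st) \<and> regs s' r_j = Suc j) s"
proof -
  note len = job_length_ok[OF core W regs(2) j(1)]
  have W4: "4 * (m * load) \<le> W" "20 \<le> W" using W by (auto simp: word_ok_def)
  have l: "load \<le> m * load" "0 < load" using load_le_m_load load_pos[OF j(1)] by auto
  show ?thesis
  proof (cases "v = Splittable")
    case False
    show ?thesis
      unfolding job_prog_def if_not_P[OF False] whole_job_prog_def seq.simps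
    proof (intro wp_Seq wp_Assign, goal_cases)
      case (3 s1 s2)
      have "regs s2 = (regs s)(r_k := 1, r_len := m * ptime I j, r_u := regs s r_u, r_a := regs s r_a,
          r_q := regs s r_q)" "mem s2 = mem s" "out s2 = out s"
        using 3 len(2) core_simps[OF core] regs j by (simp_all add: fun_eq_iff)
      note s2 = this core_cong[OF core this]
      show ?case
        by (rule wp_mono[OF wp_emit[OF s2(4) W inv emit_pre_whole[OF False j]]])
          (use s2 le regs False in \<open>auto intro!: wp_Skip\<close>)
    qed (use len W4 core_simps[OF core] regs in simp_all)
  next
    case True
    define q where "q = pos st + m * ptime I j"
    define len1 where "len1 = min (q - pos st) (load - pos st mod load)"
    define st1 where "st1 = emit j 1 len1 st"
    define k2 where "k2 = (q - pos st1) div load"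
    define st2 where "st2 = (if 0 < k2 then emit j k2 load st1 else st1)"
    note split = handle_Job_split[OF True j, folded q_def, folded len1_def,
        folded st1_def, folded k2_def, folded st2_def]
    have inv1: "inv st1" unfolding st1_def by (rule emit_inv(1)[OF inv split(2) l(2)])
    have inv2: "inv st2" using inv1 emit_inv(1)[OF inv1 split(3) l(2)] by (simp add: st2_def)
    have cur: "cur st1 = cur st" "cur st2 = cur st" by (simp_all add: st1_def st2_def)
    have q: "q \<le> m * load" "pos st \<le> q" using le by (simp_all add: q_def)
    have k2: "k2 \<le> q - pos st1" "k2 * load \<le> q - pos st1"
      unfolding k2_def by (rule div_le_dividend, rule div_times_less_eq_dividend)
    have first: "wp W emit_prog (\<lambda>t s'. t \<le> 150 \<and> core W M st1 s' \<and>
        regs s' r_i = Suc (cur st) \<and> regs s' r_j = Suc j \<and> regs s' r_q = q) s1"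
      if "core W M st s1" "regs s1 r_i = Suc (cur st)" "regs s1 r_j = Suc j" "regs s1 r_q = q"
        "regs s1 r_k = 1" "regs s1 r_len = len1" for s1
      unfolding st1_def
      by (rule wp_mono[OF wp_emit[OF that(1) W inv split(2)]])
        (use that q split(5) in \<open>simp_all add: st1_def\<close>)
    have second: "wp W emit_prog (\<lambda>t s'. t \<le> 150 \<and> core W M st2 s' \<and>
        regs s' r_i = Suc (cur st) \<and> regs s' r_j = Suc j \<and> regs s' r_q = q) s1"
      if "core W M st1 s1" "regs s1 r_i = Suc (cur st)" "regs s1 r_j = Suc j" "regs s1 r_q = q"
        "regs s1 r_k = k2" "regs s1 r_len = load" "0 < k2" for s1
      unfolding st2_def if_P[OF that(7)]
      by (rule wp_mono[OF wp_emit[OF that(1) W inv1 split(3)[OF that(7)]]])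
        (use that q split(6,7) cur in simp_all)
    have third: "wp W emit_prog (\<lambda>t s'. t \<le> 150 \<and> core W M (handle (Job j) st) s' \<and>
        regs s' r_i = Suc (cur st) \<and> regs s' r_j = Suc j) s1"
      if "core W M st2 s1" "regs s1 r_i = Suc (cur st)" "regs s1 r_j = Suc j" "regs s1 r_q = q"
        "regs s1 r_k = 1" "regs s1 r_len = q - pos st2" "pos st2 < q" for s1
      unfolding split(1) if_P[OF that(7)]
      by (rule wp_mono[OF wp_emit[OF that(1) W inv2 split(4)[OF that(7)]]])
        (use that q split(6,7) cur in simp_all)
    have mod: "pos st - pos st div load * load = pos st mod load"
      by (simp add: minus_div_mult_eq_mod)
    have div: "pos st div load \<le> pos st" "pos st div load * load \<le> pos st"
      by (rule div_le_dividend, rule div_times_less_eq_dividend)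
    have bounds: "pos st \<le> W" "q \<le> W" "load \<le> W" "pos st div load \<le> W"
      "pos st div load * load \<le> W" "1 \<le> W"
      using div q l W4 by linarith+
    have bounds2: "q - pos st1 \<le> W" "k2 \<le> W" using bounds(2) k2 by linarith+
    have cut: "wp W first_cut_prog (\<lambda>t s'. t \<le> 100 \<and> core W M st s' \<and>
        regs s' r_i = Suc (cur st) \<and> regs s' r_j = Suc j \<and> regs s' r_q = q \<and>
        regs s' r_k = 1 \<and> regs s' r_len = len1) s"
    proof (rule wp_mono[OF wp_first_cut_prog[OF len]], goal_cases)
      case (4 t s')
      then obtain a where s': "regs s' = (regs s)(r_q := q, r_k := 1, r_len := len1, r_a := a)"
        "mem s' = mem s" "out s' = out s"
        using core_simps[OF core] by (auto simp: q_def len1_def)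
      have "core W M st s'"
        by (rule core_cong[OF core _ s'(2,3), of 1 len1 "regs s r_u" a q]) (auto simp: s')
      with 4 s' regs show ?case by simp
    qed (use bounds core_simps[OF core] in \<open>simp_all add: q_def\<close>)
    have middle: "wp W middle_prog (\<lambda>t s'. t \<le> 170 \<and> core W M st2 s' \<and>
        regs s' r_i = Suc (cur st) \<and> regs s' r_j = Suc j \<and> regs s' r_q = q) s1"
      if s1: "core W M st1 s1" "regs s1 r_i = Suc (cur st)" "regs s1 r_j = Suc j" "regs s1 r_q = q" for s1
      unfolding middle_prog_def seq.simps
    proof (intro wp_Seq wp_Assign wp_If wp_Skip, goal_cases)
      case (4 s2 s3)
      then have s3: "regs s3 = (regs s1)(r_k := k2, r_len := load)" "mem s3 = mem s1" "out s3 = out s1"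
        "0 < k2"
        using s1(4) core_simps[OF s1(1)] by (simp_all add: k2_def)
      have "core W M st1 s3"
        by (rule core_cong[OF s1(1) _ s3(2,3), of k2 load "regs s1 r_u" "regs s1 r_a" q])
          (auto simp: s3 s1(4))
      from second[OF this] s3 s1 show ?case by (auto elim!: wp_mono intro!: wp_Skip)
    next
      case (5 s2)
      then have s2: "regs s2 = (regs s1)(r_k := k2)" "mem s2 = mem s1" "out s2 = out s1" "k2 = 0"
        using s1(4) core_simps[OF s1(1)] by (simp_all add: k2_def)
      have "core W M st1 s2"
        by (rule core_cong[OF s1(1) _ s2(2,3), of k2 "regs s1 r_len" "regs s1 r_u" "regs s1 r_a" q])
          (auto simp: s2 s1(4))
      with s2 s1 show ?case by (simp add: st2_def)
    qed (use s1 core_simps[OF s1(1)] bounds bounds2 split(5) in \<open>simp_all add: k2_def[symmetric]\<close>)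
    have rest: "wp W rest_prog (\<lambda>t s'. t \<le> 170 \<and> core W M (handle (Job j) st) s' \<and>
        regs s' r_i = Suc (cur st) \<and> regs s' r_j = Suc j) s1"
      if s1: "core W M st2 s1" "regs s1 r_i = Suc (cur st)" "regs s1 r_j = Suc j" "regs s1 r_q = q" for s1
      unfolding rest_prog_def seq.simps
    proof (intro wp_Seq wp_Assign wp_If wp_Skip, goal_cases)
      case (4 s2 s3)
      then have s3: "regs s3 = (regs s1)(r_k := 1, r_len := q - pos st2)"
        "mem s3 = mem s1" "out s3 = out s1" "pos st2 < q"
        using s1(4) core_simps[OF s1(1)] by (simp_all split: if_splits)
      have "core W M st2 s3"
        by (rule core_cong[OF s1(1) _ s3(2,3), of 1 "q - pos st2" "regs s1 r_u" "regs s1 r_a" q])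
          (auto simp: s3 s1(4))
      from third[OF this] s3 s1 show ?case by (auto elim!: wp_mono intro!: wp_Skip)
    next
      case 5
      then have "\<not> pos st2 < q" using s1 core_simps[OF s1(1)] by (simp split: if_splits)
      then show ?case unfolding split(1) using s1 by simp
    qed (use s1 core_simps[OF s1(1)] bounds split(7) in simp_all)
    show ?thesis
      unfolding job_prog_def if_P[OF True] split_job_prog_def seq.simps
    proof (intro wp_Seq wp_mono[OF cut], goal_cases)
      case (1 t1 s1)
      then show ?case
      proof (intro wp_Seq wp_mono[OF first], goal_cases)
        case (7 t2 s2)
        then show ?case
        proof (intro wp_Seq wp_mono[OF middle], goal_cases)
          case (5 t3 s3)
          then show ?case by (intro wp_Seq wp_Skip wp_mono[OF rest]) auto
        qed simp_all
      qed simp_all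
    qed
  qed
qed

section \<open>The main loop\<close>

text \<open>\<open>js\<close> is the rest of the current list and \<open>i\<close> the next class.
  The equation for \<open>pos\<close> keeps all later positions within \<open>m * load\<close>, as
  the word bound requires. \<open>i\<close> is tied to \<open>cur st\<close> only while jobs are
  left, since initially no class has started.\<close>

definition main_rel :: "nat \<Rightarrow> (nat \<Rightarrow> nat) \<Rightarrow> event list \<Rightarrow> sched \<Rightarrow> ram_state \<Rightarrow> bool" where
  "main_rel W M es st s \<longleftrightarrow> core W M st s \<and> inv st \<and> admissible_events (cur st) es \<and>
     pos st + sum_list (map event_width es) = m * load \<and>
     (\<exists>js i. es = map Job js @ concat (map (\<lambda>i. Start i # map Job (bucket i)) [i..<c]) \<and>
        i \<le> c \<and> regs s r_i = i \<and> chain (3 + c + n + n + c) M js (regs s r_j) \<and>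
        (js \<noteq> [] \<longrightarrow> i = Suc (cur st)))"

lemma core_cong_pointer:
  assumes "core W M st s" "regs s' = (regs s)(r_i := i, r_j := j)"
    "mem s' = mem s" "out s' = out s"
  shows "core W M st s'"
  using assms by (simp add: core_def)

lemma core_chain: "core W M st s \<Longrightarrow> i < c \<Longrightarrow>
    chain (3 + c + n + n + c) M (bucket i) (M (3 + c + n + n + i))"
  unfolding core_def by blast

lemma word_okD:
  assumes "word_ok W"
  shows "4 * (m * load) \<le> W" "10 * (n + c) + 20 \<le> W" "m \<le> W" "load \<le> W"
  using assms load_le_m_load base_le unfolding word_ok_def by linarith+

lemma wp_step_Job:
  assumes rel: "main_rel W M (Job j # es) st s" and W: "word_ok W"
  shows "fits W s main_cond \<and> eval s main_cond \<noteq> 0 \<and>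
    wp W (step_prog v) (\<lambda>t s'. t \<le> 700 \<and> main_rel W M es (handle (Job j) st) s') s"
proof -
  from rel have core: "core W M st s" and inv: "inv st" and adm: "admissible_events (cur st) (Job j # es)"
    and pos: "pos st + sum_list (map event_width (Job j # es)) = m * load"
    by (auto simp: main_rel_def)
  from rel obtain js i where es: "Job j # es = map Job js @ concat (map (\<lambda>i. Start i # map Job (bucket i)) [i..<c])"
    and i: "i \<le> c" "regs s r_i = i" and ch: "chain (3 + c + n + n + c) M js (regs s r_j)"
    and cur: "js \<noteq> [] \<longrightarrow> i = Suc (cur st)" by (auto simp: main_rel_def)
  obtain js' where js: "js = j # js'"
  proof (cases js)
    case Nil
    with es show ?thesis by (cases "i < c") (simp_all add: upt_conv_Cons)
  qed (use es that in auto)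
  have j: "j < n" "cls I j = cur st" using adm by auto
  have regs: "regs s r_i = Suc (cur st)" "regs s r_j = Suc j" using ch cur i js by auto
  have ch': "chain (3 + c + n + n + c) M js' (M (3 + c + n + n + c + j))" using ch js by simp
  have le: "pos st + m * ptime I j \<le> m * load" using pos by simp
  have Wn: "10 * (n + c) + 20 \<le> W" using word_okD[OF W] by simp
  have Mle: "M a \<le> W" for a using core unfolding core_def by blast
  note job = wp_job[OF core W inv j le regs]
  have "wp W (step_prog v) (\<lambda>t s'. t \<le> 700 \<and> main_rel W M es (handle (Job j) st) s') s"
    unfolding step_prog_def seq.simps
  proof (intro wp_If wp_Seq wp_mono[OF job], goal_cases)
    case (2 t s1)
    then have s1: "core W M (handle (Job j) st) s1" "regs s1 r_i = Suc (cur st)" "regs s1 r_j = Suc j"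
      by auto
    show ?case
    proof (intro wp_Seq wp_Assign wp_Skip, goal_cases)
      case (2 s2)
      then have s2: "regs s2 = (regs s1)(r_j := M (3 + c + n + n + c + j))" "mem s2 = mem s1" "out s2 = out s1"
        using s1 core_simps[OF s1(1)] by simp_all
      have "core W M (handle (Job j) st) s2"
        by (rule core_cong_pointer[OF s1(1) _ s2(2,3), of "Suc (cur st)" "M (3 + c + n + n + c + j)"])
          (auto simp: s2 s1(2))
      moreover have "es = map Job js' @ concat (map (\<lambda>i. Start i # map Job (bucket i)) [i..<c])"
        using es js by simp
      moreover have "i = Suc (cur st)" using cur js by simp
      ultimately have "main_rel W M es (handle (Job j) st) s2"
        unfolding main_rel_def using handle_Job(1-3)[OF inv j] adm pos ch' i s2 s1(2)
        by (auto simp del: handle.simps intro!: exI[of _ js'] exI[of _ "Suc (cur st)"])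
      with \<open>t \<le> 600 \<and> _\<close> show ?case by simp
    qed (use s1 core_simps[OF s1(1)] j Wn Mle in simp_all)
  qed (use regs j Wn in simp_all)
  moreover have "fits W s main_cond \<and> eval s main_cond \<noteq> 0"
    using regs core_simps[OF core] i j Wn by (simp add: main_cond_def)
  ultimately show ?thesis by blast
qed

lemma wp_step_Start:
  assumes rel: "main_rel W M (Start i # es) st s" and W: "word_ok W"
  shows "fits W s main_cond \<and> eval s main_cond \<noteq> 0 \<and>
    wp W (step_prog v) (\<lambda>t s'. t \<le> 700 \<and> main_rel W M es (handle (Start i) st) s') s"
proof -
  from rel have core: "core W M st s" and inv: "inv st" and adm: "admissible_events (cur st) (Start i # es)"
    and pos: "pos st + sum_list (map event_width (Start i # es)) = m * load"
    by (auto simp: main_rel_def)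
  from rel obtain js i' where es: "Start i # es = map Job js @ concat (map (\<lambda>i. Start i # map Job (bucket i)) [i'..<c])"
    and i': "i' \<le> c" "regs s r_i = i'" and ch: "chain (3 + c + n + n + c) M js (regs s r_j)"
    by (auto simp: main_rel_def)
  have js: "js = []" using es by (cases js) auto
  have "i' < c"
  proof (rule ccontr)
    assume "\<not> i' < c"
    with es js show False by simp
  qed
  then have i: "i' = i" "i < c" "es = map Job (bucket i) @ concat (map (\<lambda>i. Start i # map Job (bucket i)) [Suc i..<c])"
    using es js by (simp_all add: upt_conv_Cons)
  have regs: "regs s r_i = i" "regs s r_j = 0" using ch i' i js by auto
  have Wn: "10 * (n + c) + 20 \<le> W" "4 * (m * load) \<le> W" "m \<le> W" using word_okD[OF W] by simp_all
  have Mle: "M a \<le> W" for a using core unfolding core_def by blast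
  have b: "pos st + m * stime I i \<le> W" "m * stime I i \<le> W" "pos st \<le> W" "stime I i \<le> W"
    using pos Wn Mle[of "3 + i"] core_simps(10)[OF core i(2)] by simp_all
  have "wp W (step_prog v) (\<lambda>t s'. t \<le> 700 \<and> main_rel W M es (handle (Start i) st) s') s"
    unfolding step_prog_def seq.simps
  proof (intro wp_If, goal_cases)
    case 3
    show ?case
    proof (intro wp_Seq wp_Assign wp_Skip, goal_cases)
      case (5 s1 s2 s3 s4)
      then have s4: "regs s4 = (regs s)(r_pos := pos st + m * stime I i, r_fresh := 1,
          r_j := M (3 + c + n + n + i), r_i := Suc i)" "mem s4 = mem s" "out s4 = out s"
        using regs core_simps[OF core] i(2) by simp_all
      have "core W M (handle (Start i) st) s4"
        using core s4 unfolding core_def by simp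
      then have "main_rel W M es (handle (Start i) st) s4"
        unfolding main_rel_def using handle_Start_inv[OF inv, of i] adm pos i s4
          core_chain[OF core i(2)]
        by (auto intro!: exI[of _ "bucket i"] exI[of _ "Suc i"])
      then show ?case by simp
    qed (use regs core_simps[OF core] i(2) Wn Mle b in simp_all)
  qed (use regs in simp_all)
  moreover have "fits W s main_cond \<and> eval s main_cond \<noteq> 0"
    using regs core_simps[OF core] i Wn by (simp add: main_cond_def)
  ultimately show ?thesis by blast
qed

lemma wp_main_loop:
  assumes "main_rel W M es st s" "word_ok W"
  shows "wp W (While main_cond (step_prog v)) (\<lambda>t s'. t \<le> length es * 710 + 10 \<and>
    main_rel W M [] (fold handle es st) s') s"
proof (rule wp_mono[OF wp_While_list[where P = "main_rel W M" and f = handle and b = 700]])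
  show "main_rel W M es st s" by fact
  show "fits W s main_cond \<and> eval s main_cond \<noteq> 0 \<and>
      wp W (step_prog v) (\<lambda>t s'. t \<le> 700 \<and> main_rel W M es (handle e st) s') s"
    if "main_rel W M (e # es) st s" for e es st s
    using wp_step_Job wp_step_Start that assms(2) by (cases e) blast+
  show "fits W s main_cond \<and> eval s main_cond = 0" if "main_rel W M [] st s" for st s
  proof -
    from that have core: "core W M st s" by (simp add: main_rel_def)
    from that obtain i where "concat (map (\<lambda>i. Start i # map Job (bucket i)) [i..<c]) = []" "i \<le> c"
      "regs s r_i = i" "regs s r_j = 0" by (auto simp: main_rel_def)
    moreover from this have "i = c" by (cases "i < c") (auto simp: upt_conv_Cons)
    moreover have "c \<le> W" using word_okD(2)[OF assms(2)] by simp
    ultimately show ?thesis using core_simps[OF core] by (simp add: main_cond_def)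
  qed
qed (auto simp: main_cond_def)

section \<open>Reading the input and building the lists\<close>

text \<open>Cells behind the input are only bounded, not fixed, so that list cells may be
  written.\<close>

definition layout :: "nat \<Rightarrow> (nat \<Rightarrow> nat) \<Rightarrow> bool" where
  "layout W M \<longleftrightarrow> (\<forall>i<c. M (3 + i) = stime I i) \<and> (\<forall>j<n. M (3 + c + j) = ptime I j) \<and>
     (\<forall>j<n. M (3 + c + n + j) = cls I j) \<and> (\<forall>a. M a \<le> W)"

lemma wp_class_loop:
  assumes s: "regs s r_i = 0" "regs s r_c = c" "regs s r_load = 0" "mem s = M" "layout W M"
    and W: "word_ok W"
  shows "wp W (While (eless (Reg r_i) (Reg r_c)) class_prog) (\<lambda>t s'. t \<le> c * 24 + 4 \<and>
    mem s' = M \<and> out s' = out s \<and> regs s' = (regs s)(r_i := c, r_load := \<Sum>i<c. stime I i)) s"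
proof (rule wp_mono[OF wp_While_upt[where b = 20 and N = c and
      P = "\<lambda>i s'. mem s' = M \<and> out s' = out s \<and> regs s' = (regs s)(r_i := i, r_load := \<Sum>i<i. stime I i)"]])
  show "mem s = M \<and> out s = out s \<and> regs s = (regs s)(r_i := 0, r_load := \<Sum>i<0. stime I i)"
    using s by (simp add: fun_eq_iff)
  have Wn: "10 * (n + c) + 20 \<le> W" "load \<le> W" using word_okD[OF W] by simp_all
  show "fits W s1 (eless (Reg r_i) (Reg r_c)) \<and> eval s1 (eless (Reg r_i) (Reg r_c)) \<noteq> 0 \<and>
      wp W class_prog (\<lambda>t s'. t \<le> 20 \<and> mem s' = M \<and> out s' = out s \<and>
        regs s' = (regs s)(r_i := Suc i, r_load := \<Sum>i<Suc i. stime I i)) s1"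
    if i: "i < c" and s1: "mem s1 = M \<and> out s1 = out s \<and>
      regs s1 = (regs s)(r_i := i, r_load := \<Sum>i<i. stime I i)" for i s1
  proof -
    have "(\<Sum>i<Suc i. stime I i) \<le> (\<Sum>i<c. stime I i)" using i by (intro sum_mono2) auto
    then have "(\<Sum>i<Suc i. stime I i) \<le> W" using Wn by (simp add: load_def)
    then have sum: "(\<Sum>i<i. stime I i) + stime I i \<le> W" by simp
    have "M (3 + i) = stime I i" "M (3 + i) \<le> W" using s(5) i unfolding layout_def by blast+
    then have M: "M (3 + i) = stime I i" "stime I i \<le> W" by auto
    have "wp W class_prog (\<lambda>t s'. t \<le> 20 \<and> mem s' = M \<and> out s' = out s \<and>
        regs s' = (regs s)(r_i := Suc i, r_load := \<Sum>i<Suc i. stime I i)) s1"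
      unfolding class_prog_def seq.simps
      by (intro wp_intros) (use s s1 M i sum Wn in \<open>simp_all add: fun_eq_iff\<close>)
    then show ?thesis using s s1 i Wn by simp
  qed
  show "fits W s1 (eless (Reg r_i) (Reg r_c)) \<and> eval s1 (eless (Reg r_i) (Reg r_c)) = 0"
    if "mem s1 = M \<and> out s1 = out s \<and> regs s1 = (regs s)(r_i := c, r_load := \<Sum>i<c. stime I i)" for s1
    using that s Wn by simp
qed auto

lemma width_le: "j < n \<Longrightarrow> word_ok W \<Longrightarrow> width j \<le> W"
  using width_le_load[of j] word_okD(4)[of W] by simp

lemma wp_read_prog:
  assumes j: "j < n" and W: "word_ok W" and M: "layout W (mem s)"
    and s: "regs s r_j = j" "regs s r_c = c" "regs s r_n = n" "regs s r_load + ptime I j \<le> W"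
      "regs s r_base \<le> W"
  shows "wp W (read_prog v) (\<lambda>t s'. t \<le> 100 \<and> mem s' = mem s \<and> out s' = out s \<and>
    regs s' = (regs s)(r_q := cls I j, r_load := regs s r_load + ptime I j, r_a := width j,
      r_base := max (regs s r_base) (width j))) s"
proof -
  have Wn: "10 * (n + c) + 20 \<le> W" using word_okD[OF W] by simp
  have ic: "cls I j < c" using class_less[OF j] .
  have Mle: "mem s a \<le> W" for a using M unfolding layout_def by blast
  have M': "mem s (3 + c + n + j) = cls I j" "mem s (3 + c + j) = ptime I j"
    "mem s (3 + cls I j) = stime I (cls I j)"
    using M j ic by (auto simp: layout_def)
  have w: "width j \<le> W" by (rule width_le[OF j W])
  have le: "cls I j \<le> W" "ptime I j \<le> W" "stime I (cls I j) \<le> W"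
    using Mle[of "3 + c + n + j"] Mle[of "3 + c + j"] Mle[of "3 + cls I j"] M' by simp_all
  show ?thesis
  proof (cases "v = Splittable")
    case True
    then have "width j = stime I (cls I j)" unfolding width_def by simp
    then show ?thesis
      unfolding read_prog_def if_P[OF True] seq.simps
      by (intro wp_intros)
        (use s M' le w Wn j ic in \<open>simp_all add: fun_eq_iff split: if_splits\<close>)
  next
    case False
    then have "width j = stime I (cls I j) + ptime I j" unfolding width_def by simp
    then show ?thesis
      unfolding read_prog_def if_not_P[OF False] seq.simps
      by (intro wp_intros)
        (use s M' le w Wn j ic in \<open>simp_all add: fun_eq_iff split: if_splits\<close>)
  qed
qed

definition bucket_upto :: "nat \<Rightarrow> nat \<Rightarrow> nat list" where
  "bucket_upto j i = rev (filter (\<lambda>j. cls I j = i) [0..<j])"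

definition read_inv :: "nat \<Rightarrow> nat \<Rightarrow> ram_state \<Rightarrow> bool" where
  "read_inv W j s \<longleftrightarrow> layout W (mem s) \<and> out s = [] \<and> regs s r_m = m \<and> regs s r_n = n \<and>
     regs s r_c = c \<and> regs s r_j = j \<and> regs s r_pos = 0 \<and> regs s r_used = 0 \<and> regs s r_fresh = 0 \<and>
     regs s r_load = (\<Sum>i<c. stime I i) + (\<Sum>j<j. ptime I j) \<and>
     regs s r_base = Max (insert 0 (width ` {..<j})) \<and>
     (\<forall>i<c. chain (3 + c + n + n + c) (mem s) (bucket_upto j i) (mem s (3 + c + n + n + i)))"

lemma wp_read_job:
  assumes inv: "read_inv W j s" and j: "j < n" and W: "word_ok W"
  shows "wp W (read_job_prog v) (\<lambda>t s'. t \<le> 150 \<and> read_inv W (Suc j) s') s"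
proof -
  define H where "H = 3 + c + n + n"
  have Wn: "10 * (n + c) + 20 \<le> W" "load \<le> W" using word_okD[OF W] by simp_all
  have ic: "cls I j < c" using class_less[OF j] .
  have M: "layout W (mem s)" and s: "regs s r_j = j" "regs s r_c = c" "regs s r_n = n"
    using inv by (auto simp: read_inv_def)
  have Mle: "mem s a \<le> W" for a using M unfolding layout_def by blast
  have "(\<Sum>j<Suc j. ptime I j) \<le> (\<Sum>j<n. ptime I j)" using j by (intro sum_mono2) auto
  then have load: "regs s r_load + ptime I j \<le> W"
    using inv Wn by (simp add: read_inv_def load_def)
  have "Max (insert 0 (width ` {..<j})) \<le> W"
    using j W by (intro Max.boundedI) (auto intro: width_le)
  then have base: "regs s r_base \<le> W" using inv by (simp add: read_inv_def)
  show ?thesis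
    unfolding read_job_prog_def seq.simps
  proof (intro wp_Seq wp_mono[OF wp_read_prog[OF j W M s load base]], goal_cases)
    case (1 t s1)
    then have s1: "mem s1 = mem s" "out s1 = out s"
      "regs s1 = (regs s)(r_q := cls I j, r_load := regs s r_load + ptime I j, r_a := width j,
         r_base := max (regs s r_base) (width j))" by auto
    have regs1: "regs s1 r_j = j" "regs s1 r_c = c" "regs s1 r_n = n" "regs s1 r_q = cls I j"
      using s1 s by simp_all
    show ?case
      unfolding link_prog_def seq.simps
    proof (intro wp_Seq wp_Store wp_Assign wp_Skip, goal_cases)
      case (6 s2 s3 s4)
      then have s4: "regs s4 = (regs s1)(r_j := Suc j)" "out s4 = out s"
        "mem s4 = (mem s)(H + c + j := mem s (H + cls I j), H + cls I j := Suc j)"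
        using s1 regs1 by (simp_all add: H_def)
      have far: "mem s4 a = mem s a" if "a < H" for a using that s4 by simp
      have "layout W (mem s4)"
        unfolding layout_def
      proof (intro conjI allI impI)
        show "mem s4 a \<le> W" for a using s4 Mle[of a] Mle[of "H + cls I j"] j Wn by simp
      qed (use M far in \<open>simp_all add: layout_def H_def\<close>)
      moreover have "chain (H + c) (mem s4) (bucket_upto (Suc j) i) (mem s4 (H + i))" if i: "i < c" for i
      proof -
        have old: "chain (H + c) (mem s) (bucket_upto j i) (mem s (H + i))"
          using inv i by (simp add: read_inv_def H_def)
        \<comment> \<open>Listed jobs are smaller than \<open>j\<close>, and heads lie below
          \<open>H + c\<close>, so neither written cell is a link of an older job.\<close>
        have "mem s4 (H + c + j') = mem s (H + c + j')" if "j' \<in> set (bucket_upto j i)" for j'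
          using that ic s4 by (auto simp: bucket_upto_def)
        with old have keep: "chain (H + c) (mem s4) (bucket_upto j i) (mem s (H + i))"
          using chain_cong[of "bucket_upto j i" "mem s4" "H + c" "mem s" "mem s (H + i)"] by simp
        show ?thesis
        proof (cases "cls I j = i")
          case True
          with keep ic show ?thesis using s4 by (simp add: bucket_upto_def)
        next
          case False
          moreover have "mem s4 (H + i) = mem s (H + i)" using False i s4 by simp
          ultimately show ?thesis using keep by (simp add: bucket_upto_def)
        qed
      qed
      moreover have "Max (insert 0 (width ` {..<Suc j})) = max (Max (insert 0 (width ` {..<j}))) (width j)"
      proof -
        have "insert 0 (width ` {..<Suc j}) = insert (width j) (insert 0 (width ` {..<j}))"
          by (auto simp: lessThan_Suc)
        then show ?thesis by (simp add: max.commute)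
      qed
      ultimately have "read_inv W (Suc j) s4"
        using inv s4 s1 unfolding read_inv_def by (simp add: H_def)
      with 1 show ?case by simp
    qed (use regs1 s1 j ic Wn Mle in simp_all)
  qed
qed

lemma wp_read_loop:
  assumes "read_inv W 0 s" and W: "word_ok W"
  shows "wp W (While (eless (Reg r_j) (Reg r_n)) (read_job_prog v))
    (\<lambda>t s'. t \<le> n * 154 + 4 \<and> read_inv W n s') s"
proof -
  have nW: "n \<le> W" "1 \<le> W" using word_okD[OF W] by simp_all
  show ?thesis
  proof (rule wp_mono[OF wp_While_upt[where P = "read_inv W" and b = 150 and N = n]])
    show "read_inv W 0 s" by fact
    show "fits W s (eless (Reg r_j) (Reg r_n)) \<and> eval s (eless (Reg r_j) (Reg r_n)) \<noteq> 0 \<and>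
        wp W (read_job_prog v) (\<lambda>t s'. t \<le> 150 \<and> read_inv W (Suc j) s') s"
      if "j < n" "read_inv W j s" for j s
      using that wp_read_job[OF that(2,1) W] nW by (simp add: read_inv_def)
    show "fits W s (eless (Reg r_j) (Reg r_n)) \<and> eval s (eless (Reg r_j) (Reg r_n)) = 0"
      if "read_inv W n s" for s
      using that nW by (simp add: read_inv_def)
  qed simp
qed

section \<open>Linear time and the word bound\<close>

lemma length_events: "length events = c + n"
  using sum_list_events[of "\<lambda>_. 1 :: nat"] by (simp add: sum_list_triv)

text \<open>No class is empty, so \<open>cls I\<close> maps the jobs onto the classes. This turns a
  time linear in \<open>c + n\<close> into one linear in \<open>n\<close>.\<close>

lemma nclasses_le_njobs: "c \<le> n"
proof -
  have "{..<c} \<subseteq> cls I ` {..<n}"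
    using valid by (fastforce simp: valid_instance_def class_jobs_def)
  then have "card {..<c} \<le> card (cls I ` {..<n})" by (intro card_mono) auto
  also have "\<dots> \<le> card {..<n}" by (rule card_image_le) simp
  finally show ?thesis by simp
qed

definition input :: "nat list" where
  "input = encode_instance I"

lemma length_input: "length input = 3 + c + n + n"
  by (simp add: input_def encode_instance_def)

lemma input_nth:
  "input ! 0 = m" "input ! 1 = n" "input ! 2 = c"
  "i < c \<Longrightarrow> input ! (3 + i) = stime I i"
  "j < n \<Longrightarrow> input ! (3 + c + j) = ptime I j"
  "j < n \<Longrightarrow> input ! (3 + c + n + j) = cls I j"
  by (simp_all add: input_def encode_instance_def nth_append nth_Cons numeral_eq_Suc)

lemma input_le:
  assumes "a < length input"
  shows "input ! a \<le> Max (set input)"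
  using assms by (intro Max_ge) auto

text \<open>\<open>B\<close> dominates \<open>n + c\<close>, \<open>m\<close> and every input
  number, so \<open>load\<close> is at most \<open>B * B\<close> and \<open>m * load\<close> at most
  \<open>P\<close>, the cube of \<open>B\<close>. Squaring to exponent 6 absorbs the constants, as
  \<open>4 \<le> B\<close> gives \<open>64 * P \<le> P * P\<close>.\<close>

lemma word_ok_word_bound: "word_ok (word_bound 6 input)" "Max (set input) \<le> word_bound 6 input"
proof -
  define X where "X = Max (set input)"
  define B where "B = length input + X"
  have m: "m \<le> X" using input_le[of 0] input_nth(1) length_input by (simp add: X_def)
  have B: "4 \<le> B" "n + c + 3 \<le> B" "m \<le> B" "X \<le> B"
    using m m_pos by (simp_all add: B_def length_input)
  have "stime I i \<le> X" if "i < c" for i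
    using input_le[of "3 + i"] input_nth(4)[OF that] that length_input by (simp add: X_def)
  then have "(\<Sum>i<c. stime I i) \<le> c * X" using sum_bounded_above[of "{..<c}" "stime I" X] by simp
  moreover have "ptime I j \<le> X" if "j < n" for j
    using input_le[of "3 + c + j"] input_nth(5)[OF that] that length_input by (simp add: X_def)
  then have "(\<Sum>j<n. ptime I j) \<le> n * X" using sum_bounded_above[of "{..<n}" "ptime I" X] by simp
  ultimately have "load \<le> (n + c) * X" by (simp add: load_def algebra_simps)
  also have "\<dots> \<le> B * B" using B by (intro mult_mono) auto
  finally have load: "m * load \<le> B * (B * B)" using B by (intro mult_mono) auto
  define P where "P = B * (B * B)"
  have "4 * 4 \<le> B * B" using B(1) by (intro mult_mono) auto
  then have "B * 16 \<le> P" unfolding P_def by (intro mult_left_mono) auto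
  moreover have "4 * (4 * 4) \<le> P" unfolding P_def using B(1) by (intro mult_mono) auto
  then have "64 * P \<le> P * P" by (intro mult_right_mono) auto
  moreover have "P * P = word_bound 6 input"
    by (simp add: P_def word_bound_def B_def X_def eval_nat_numeral)
  moreover have "m * load \<le> P" using load by (simp add: P_def)
  ultimately have P: "64 * P \<le> word_bound 6 input" "m * load \<le> P" "B * 16 \<le> P" by auto
  have "4 * (m * load) + 10 * (n + c) + 20 \<le> 4 * P + 10 * B" using P(2) B(2) by simp
  also have "\<dots> \<le> word_bound 6 input" using P(1,3) by simp
  finally have "4 * (m * load) + 10 * (n + c) + 20 \<le> word_bound 6 input" .
  moreover have "m \<le> word_bound 6 input" "X \<le> word_bound 6 input"
    using P(1,3) B(3,4) by simp_all
  ultimately show "word_ok (word_bound 6 input)" "X \<le> word_bound 6 input"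
    by (simp_all add: word_ok_def)
qed

lemma layout_input: "layout (word_bound 6 input) (mem (initial_state input))"
proof -
  have "mem (initial_state input) a \<le> word_bound 6 input" for a
    using order_trans[OF input_le word_ok_word_bound(2)] by (simp add: initial_state_def)
  then show ?thesis
    using input_nth by (simp add: layout_def initial_state_def length_input)
qed

lemma read_inv_start:
  assumes "mem s = mem (initial_state input)" "out s = []"
    "regs s = (\<lambda>_. 0)(r_m := m, r_n := n, r_c := c, r_i := i, r_load := \<Sum>i<c. stime I i)"
  shows "read_inv (word_bound 6 input) 0 s"
  using assms layout_input
  by (simp add: read_inv_def initial_state_def length_input bucket_upto_def)

lemma main_rel_start:
  assumes "read_inv W n s"
    "regs s' = (regs s)(r_base := m * regs s r_base, r_i := 0, r_j := 0)" "mem s' = mem s" "out s' = [m]"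
  shows "main_rel W (mem s) events start_sched s'"
proof -
  have "core W (mem s) start_sched s'"
    using assms unfolding core_def read_inv_def layout_def
    by (simp add: start_sched_def base_def load_def bucket_def bucket_upto_def)
  then show ?thesis
    using inv_start_sched admissible_events_events event_width_events assms(2)
    unfolding main_rel_def
    by (auto simp: start_sched_def events_def intro!: exI[of _ "[]"] exI[of _ 0])
qed

lemma wp_schedule_prog:
  "wp (word_bound 6 input) (schedule_prog v)
    (\<lambda>t s'. t \<le> 2000 * (n + 1) \<and> out s' = encode_schedule result) (initial_state input)"
proof -
  let ?W = "word_bound 6 input"
  note W = word_ok_word_bound(1)
  have Wn: "10 * (n + c) + 20 \<le> ?W" "m \<le> ?W" "4 * (m * load) \<le> ?W" using word_okD[OF W] by simp_all
  let ?s = "initial_state input"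
  have init: "mem ?s 0 = m" "mem ?s (Suc 0) = n" "mem ?s 2 = c" "regs ?s = (\<lambda>_. 0)" "out ?s = []"
    using input_nth(1-3) length_input by (simp_all add: initial_state_def)
  show ?thesis
    unfolding schedule_prog_def seq.simps
  proof (intro wp_Seq wp_Assign, goal_cases)
    case (4 s1 s2 s3)
    then have s3: "regs s3 = (\<lambda>_. 0)(r_m := m, r_n := n, r_c := c)" "mem s3 = mem ?s" "out s3 = []"
      using init by simp_all
    note cl = wp_class_loop[of s3 "mem ?s" ?W, OF _ _ _ s3(2) layout_input W]
    show ?case
    proof (intro wp_Seq wp_mono[OF cl], goal_cases)
      case (4 t4 s4)
      have "read_inv ?W 0 s4"
        by (rule read_inv_start[where i = c]) (use 4 s3 in \<open>auto simp: fun_eq_iff\<close>)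
      note rl = wp_read_loop[OF this W]
      show ?case
      proof (intro wp_Seq wp_mono[OF rl], goal_cases)
        case (1 t5 s5)
        then have inv5: "read_inv ?W n s5" by simp
        then have s5: "regs s5 r_m = m" "m * regs s5 r_base = base" "out s5 = []"
          by (simp_all add: read_inv_def base_def)
        have b5: "regs s5 r_base \<le> ?W" "m * regs s5 r_base \<le> ?W"
        proof -
          have "regs s5 r_base \<le> base" using s5(2) m_pos by (metis le_add1 mult_eq_if not_gr_zero)
          then show "regs s5 r_base \<le> ?W" "m * regs s5 r_base \<le> ?W"
            using s5(2) base_le Wn by linarith+
        qed
        show ?case
        proof (intro wp_Seq wp_Assign wp_Output, goal_cases)
          case (5 s6 s7 s8 s9)
          then have s9: "regs s9 = (regs s5)(r_base := m * regs s5 r_base, r_i := 0, r_j := 0)"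
            "mem s9 = mem s5" "out s9 = [m]"
            using s5 by simp_all
          note ml = wp_main_loop[OF main_rel_start[OF inv5 s9] W]
          show ?case
          proof (intro wp_Seq wp_Skip wp_mono[OF ml], goal_cases)
            case (1 t10 s10)
            then have "out s10 = encode_schedule result"
              by (simp add: main_rel_def core_def encode_schedule_def result_def)
            \<comment> \<open>By \<open>c \<le> n\<close> the three loops need at most
              \<open>1598 * n + 18\<close> steps; 2000 leaves room for the straight-line
              code.\<close>
            moreover have "t4 \<le> c * 24 + 4" "t5 \<le> n * 154 + 4" "t10 \<le> (c + n) * 710 + 10"
              using 1 4 \<open>t5 \<le> _ \<and> _\<close> by (simp_all add: length_events)
            ultimately show ?case using nclasses_le_njobs by simp
          qed
        qed (use s5 b5 Wn in simp_all)
      qed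
    qed (use s3 in simp_all)
  qed (use init Wn in simp_all)
qed

end

theorem theorem3p1:
  fixes v :: variant
  shows "\<exists>(p :: prog) (\<kappa> :: nat) (T :: nat \<Rightarrow> nat).
    (\<lambda>n. real (T n)) \<in> O(\<lambda>n. real n) \<and>
    (\<forall>I :: batch_instance. valid_instance I \<longrightarrow>
      (\<exists>(K :: compact_schedule) (t :: nat).
        computes_in p \<kappa> (encode_instance I) t (encode_schedule K) \<and>
        t \<le> T (njobs I) \<and>
        admissible_output v K \<and>
        feasible v I (expand I K) \<and>
        makespan I (expand I K) \<le> 2 * OPT v I))"
proof (intro exI[of _ "schedule_prog v"] exI[of _ 6] exI[of _ "\<lambda>n. 2000 * (n + 1)"] conjI allI impI)
  show "(\<lambda>n. real (2000 * (n + 1))) \<in> O(\<lambda>n. real n)"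
    \<comment> \<open>\<open>2000 * (n + 1) \<le> 4000 * n\<close> holds from \<open>n = 1\<close>
      on.\<close>
    by (rule bigoI[of _ 4000]) (auto intro!: eventually_sequentiallyI[of 1])
next
  fix I :: batch_instance
  assume "valid_instance I"
  then interpret batch I v by unfold_locales
  from wp_schedule_prog obtain t where "t \<le> 2000 * (njobs I + 1)"
    "computes_in (schedule_prog v) 6 (encode_instance I) t (encode_schedule result)"
    by (auto simp: wp_def computes_in_def input_def)
  then show "\<exists>K t. computes_in (schedule_prog v) 6 (encode_instance I) t (encode_schedule K) \<and>
      t \<le> 2000 * (njobs I + 1) \<and> admissible_output v K \<and> feasible v I (expand I K) \<and>
      makespan I (expand I K) \<le> 2 * OPT v I"
    using admissible_result feasible_result makespan_result_le_OPT by blast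
qed

end
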